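(* For any finite admissible system $(X,\mu,\overline\delta,\{\widetilde F_i\mid i\in I\})$, the edge-colored directed graph $\mathcal G(X)$ is the fibrous edge-colored Hasse diagram of a $\Phi$-structured poset. Fix a total ordering of $I$. Then for each $J\subseteq I$ and $\nu=\sum_{j\in J}\nu_j\omega_j^J\in\Lambda_{\Phi_J}^+$, the function $\kappa:\mathcal G(X)\setminus\mathcal M_{J,\nu}(\mathcal G(X))\to J$ given by $$\kappa(\mathbf x)=\min\Bigl\{i\in\mathcal K_{J,\nu}(\mathbf x): t(\mathbf x^{(i)},i)=\min_{k\in\mathcal K_{J,\nu}(\mathbf x)}\{t(\mathbf x^{(k)},k)\}\Bigr\}$$ is a $(J,\nu)$-coloring of $\mathcal G(X)$. In particular, $\mathcal G(X)$ is a crystalline splitting poset and for each such pair $(J,\nu)$ we have $$\chi^{\Phi_J}_\nu\cdot\mathrm{WGF}(\mathcal G(X))|_J=\sum_{\mathbf m\in\mathcal M_{J,\nu}(\mathcal G(X))}\chi^{\Phi_J}_{\nu+wt^J(\mathbf m)}.$$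
   Context: Root systems. $\Phi$ is a finite (reduced, crystallographic) root system in a Euclidean space with simple roots $\{\alpha_i\}_{i\in I}$, $\alpha^\vee=2\alpha/\langle\alpha,\alpha\rangle$, fundamental weights $\omega_i$ dual to simple coroots, $\Lambda=\bigoplus\mathbb Z\omega_i$, $\Lambda^+=\bigoplus\mathbb Z_{\ge0}\omega_i$, Weyl group $W$, $\varrho=\sum\omega_i$. $\mathbb Z[\Lambda]$ is the group ring with basis $\{e^\mu\}$; $\mathcal A(e^\mu)=\sum_{w\in W}\det(w)e^{w(\mu)}$. For $\lambda\in\Lambda^+$ the Weyl bialternant $\chi_\lambda$ is the unique element of $\mathbb Z[\Lambda]$ with $\mathcal A(e^\varrho)\chi_\lambda=\mathcal A(e^{\lambda+\varrho})$. For $J\subseteq I$, $\Phi_J$ is the root subsystem with simple roots $\{\alpha_j\}_{j\in J}$, with fundamental weights $\omega_j^J$, weight lattice $\Lambda_{\Phi_J}$, dominant weights $\Lambda_{\Phi_J}^+$, bialternants $\chi^{\Phi_J}_\nu$. For $\mu=\sum m_i\omega_i$ put $\mu^J=\sum_{j\in J}m_j\omega_j^J$, and for $\chi=\sum c_\mu e^\mu$ put $\chi|_J=\sum c_\mu e^{\mu^J}$. Admissible systems. Given a finite set $X$, maps $\mu,\overline\delta:X\to\Lambda$, and for each $i\in I$ a bijection $\widetilde F_i$ between two subsets of $X$, put $\varepsilon(\mathbf x)=\mu(\mathbf x)-\overline\delta(\mathbf x)$, $\mu(\mathbf x,i)=\langle\mu(\mathbf x),\alpha_i^\vee\rangle$,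 $\overline\delta(\mathbf x,i)=\langle\overline\delta(\mathbf x),\alpha_i^\vee\rangle$, $\varepsilon(\mathbf x,i)=\langle\varepsilon(\mathbf x),\alpha_i^\vee\rangle$; write $\mathbf x\preceq_i\mathbf y$ (equivalently $\mathbf y\succeq_i\mathbf x$) if $\mathbf x=\widetilde F_i^k(\mathbf y)$ for some $k\ge0$. The 4-tuple is an admissible system if: (A1) $\overline\delta(\mathbf x)\in-\Lambda^+$ and $\varepsilon(\mathbf x)\in\Lambda^+$ for all $\mathbf x$; (A2) $\widetilde F_i$ is a bijection $\{\mathbf x:\varepsilon(\mathbf x,i)>0\}\to\{\mathbf x:\overline\delta(\mathbf x,i)<0\}$; (A3) where defined, $\mu(\widetilde F_i(\mathbf x))=\mu(\mathbf x)-\alpha_i$ and $\overline\delta(\widetilde F_i(\mathbf x),i)=\overline\delta(\mathbf x,i)-1$; (A4) there is a coherent timing pattern, i.e. a real-valued function $t(\mathbf x,i)$ defined for all $\mathbf x\in X$, $i\in I$ with $\overline\delta(\mathbf x,i)<0$ such that (i) if $t(\mathbf x,i)$ and $\widetilde F_i(\mathbf x)$ are defined then $t(\mathbf x,i)\le t(\widetilde F_i(\mathbf x),i)$, and (ii) when $t(\mathbf x,i)$ and $\widetilde F_i(\mathbf x)$ are defined, for all $j\ne i$, all integers $d<0$ and all $t\le t(\mathbf x,i)$, there is $\mathbf y\succeq_j\mathbf x$ with $\overline\delta(\mathbf y,j)=d$ and $t(\mathbf y,j)=t$ if and only if there is $\mathbf y'\succeq_j\widetilde F_i(\mathbf x)$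 with $\overline\delta(\mathbf y',j)=d$ and $t(\mathbf y',j)=t$. The graph $\mathcal G(X)$ has vertex set $X$ and edges $\mathbf s\xrightarrow{i}\mathbf t$ iff $\mathbf s=\widetilde F_i(\mathbf t)$. Posets. All posets are finite, identified with Hasse diagrams. Ranked means there is a surjection $\rho:R\to\{0,\dots,l\}$ with $\rho(\mathbf s)+1=\rho(\mathbf t)$ whenever $\mathbf s\to\mathbf t$; $l$ is the length. For a ranked poset with Hasse edges colored by $I$, $\mathrm{comp}_i(\mathbf x)$ is the connected component of $\mathbf x$ using only color $i$ edges; $\rho_i(\mathbf x)$ is the rank of $\mathbf x$ there, $l_i(\mathbf x)$ its length, $\delta_i=l_i-\rho_i$, $m_i=\rho_i-\delta_i$, $wt^J(\mathbf x)=\sum_{j\in J}m_j(\mathbf x)\omega_j^J$, $wt=wt^I$, $\mathrm{WGF}(R)=\sum_{\mathbf x}e^{wt(\mathbf x)}$. $R$ is $\Phi$-structured if $wt(\mathbf s)+\alpha_i=wt(\mathbf t)$ whenever $\mathbf s\xrightarrow{i}\mathbf t$; fibrous if every $\mathrm{comp}_i(\mathbf x)$ is a chain. For fibrous $R$: $\mathcal M_{J,\nu}(R)=\{\mathbf m\in R:\delta_j(\mathbf m)\le\nu_j\ \forall j\in J\}$, $\mathcal K_{J,\nu}(\mathbf x)=\{j\in J:\delta_j(\mathbf x)>\nu_j\}$; for $i\in\mathcal K_{J,\nu}(\mathbf x)$, $\mathbf x^{(i)}$ is the unique element of $\mathrm{comp}_i(\mathbf x)$ with $\delta_i(\mathbf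 x^{(i)})=\nu_i+1$; $U_i(\mathbf x,p)$ is the set of the topmost $1+p$ elements of the chain $\mathrm{comp}_i(\mathbf x)$ (all of it if it has fewer). A $(J,\nu)$-coloring is a function $\kappa:R\setminus\mathcal M_{J,\nu}(R)\to J$ such that for all $\mathbf x$ in its domain, with $j=\kappa(\mathbf x)$, $\{\mathbf y\in\mathrm{comp}_j(\mathbf x):\mathbf y\notin\mathcal M_{J,\nu}(R),\kappa(\mathbf y)=j\}=\mathrm{comp}_j(\mathbf x)\setminus U_j(\mathbf x,\nu_j)$. A $\Phi$-structured fibrous poset $R$ is a crystalline splitting poset if for each $J\subseteq I$, $\nu\in\Lambda_{\Phi_J}^+$ there is a subset $\mathcal S_{J,\nu}(R)$ such that $\nu+wt^J(\mathbf s)\in\Lambda_{\Phi_J}^+$ for all $\mathbf s\in\mathcal S_{J,\nu}(R)$ and $\chi^{\Phi_J}_\nu\cdot\mathrm{WGF}(R)|_J=\sum_{\mathbf s\in\mathcal S_{J,\nu}(R)}\chi^{\Phi_J}_{\nu+wt^J(\mathbf s)}$. *)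

theory Defs
  imports "HOL-Analysis.Analysis" "HOL-Library.Poly_Mapping"
begin

section \<open>Root systems and weights\<close>

definition coroot :: "real^'n \<Rightarrow> real^'n" where
  "coroot \<beta> = (2 / (\<beta> \<bullet> \<beta>)) *\<^sub>R \<beta>"

definition reflection :: "real^'n \<Rightarrow> real^'n \<Rightarrow> real^'n" where
  "reflection \<beta> v = v - (v \<bullet> coroot \<beta>) *\<^sub>R \<beta>"

text \<open>Finite, reduced, crystallographic root systems. The roots are not required to span the
  ambient space; weights are taken inside the span of the roots, so that the subsystems attached
  to subsets of the simple roots are instances of the same notions.\<close>

definition root_system :: "(real^'n) set \<Rightarrow> bool" where
  "root_system \<Phi> \<longleftrightarrow>
     finite \<Phi> \<and> 0 \<notin> \<Phi> \<and>
     (\<forall>\<beta>\<in>\<Phi>. reflection \<beta> ` \<Phi> = \<Phi>) \<and>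
     (\<forall>\<beta>\<in>\<Phi>. \<forall>c. c *\<^sub>R \<beta> \<in> \<Phi> \<longrightarrow> c = 1 \<or> c = -1) \<and>
     (\<forall>\<beta>\<in>\<Phi>. \<forall>\<gamma>\<in>\<Phi>. \<gamma> \<bullet> coroot \<beta> \<in> \<int>)"

definition simple_roots :: "(real^'n) set \<Rightarrow> 'i set \<Rightarrow> ('i \<Rightarrow> real^'n) \<Rightarrow> bool" where
  "simple_roots \<Phi> I \<alpha> \<longleftrightarrow>
     finite I \<and> inj_on \<alpha> I \<and> \<alpha> ` I \<subseteq> \<Phi> \<and> independent (\<alpha> ` I) \<and>
     (\<forall>\<beta>\<in>\<Phi>. \<exists>c :: 'i \<Rightarrow> nat.
        \<beta> = (\<Sum>i\<in>I. real (c i) *\<^sub>R \<alpha> i) \<or> \<beta> = - (\<Sum>i\<in>I. real (c i) *\<^sub>R \<alpha> i))"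

definition root_subsystem :: "(real^'n) set \<Rightarrow> ('i \<Rightarrow> real^'n) \<Rightarrow> 'i set \<Rightarrow> (real^'n) set" where
  "root_subsystem \<Phi> \<alpha> J = \<Phi> \<inter> span (\<alpha> ` J)"

definition pairing :: "('i \<Rightarrow> real^'n) \<Rightarrow> real^'n \<Rightarrow> 'i \<Rightarrow> real" where
  "pairing \<alpha> v i = v \<bullet> coroot (\<alpha> i)"

definition fund_weight :: "('i \<Rightarrow> real^'n) \<Rightarrow> 'i set \<Rightarrow> 'i \<Rightarrow> real^'n" where
  "fund_weight \<alpha> J j =
     (THE w. w \<in> span (\<alpha> ` J) \<and> (\<forall>k\<in>J. pairing \<alpha> w k = (if k = j then 1 else 0)))"

definition weight_vec :: "('i \<Rightarrow> real^'n) \<Rightarrow> 'i set \<Rightarrow> ('i \<Rightarrow> real) \<Rightarrow> real^'n" where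
  "weight_vec \<alpha> J c = (\<Sum>j\<in>J. c j *\<^sub>R fund_weight \<alpha> J j)"

definition weight_lattice :: "('i \<Rightarrow> real^'n) \<Rightarrow> 'i set \<Rightarrow> (real^'n) set" where
  "weight_lattice \<alpha> J = {weight_vec \<alpha> J (\<lambda>j. of_int (c j)) | c :: 'i \<Rightarrow> int. True}"

definition dominant_weights :: "('i \<Rightarrow> real^'n) \<Rightarrow> 'i set \<Rightarrow> (real^'n) set" where
  "dominant_weights \<alpha> J = {weight_vec \<alpha> J (\<lambda>j. of_nat (c j)) | c :: 'i \<Rightarrow> nat. True}"

definition weyl_vector :: "('i \<Rightarrow> real^'n) \<Rightarrow> 'i set \<Rightarrow> real^'n" where
  "weyl_vector \<alpha> J = (\<Sum>j\<in>J. fund_weight \<alpha> J j)"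

text \<open>Reflections are involutions, so closing under composition yields the generated group.\<close>

inductive_set weyl_group :: "(real^'n) set \<Rightarrow> (real^'n \<Rightarrow> real^'n) set"
  for \<Phi> :: "(real^'n) set" where
  weyl_id: "id \<in> weyl_group \<Phi>"
| weyl_reflection: "\<beta> \<in> \<Phi> \<Longrightarrow> w \<in> weyl_group \<Phi> \<Longrightarrow> reflection \<beta> \<circ> w \<in> weyl_group \<Phi>"


section \<open>Weyl bialternants\<close>

text \<open>The group ring of the weight lattice is the subring of the group ring
  \<^typ>\<open>real^'n \<Rightarrow>\<^sub>0 int\<close> of the ambient additive group formed by the elements supported on the
  lattice; \<open>Poly_Mapping.single \<mu> c\<close> is $c\,e^\mu$. Determinants of Weyl group elements are
  $\pm1$, so taking the floor only changes the type.\<close>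

definition alternant :: "(real^'n) set \<Rightarrow> real^'n \<Rightarrow> (real^'n \<Rightarrow>\<^sub>0 int)" where
  "alternant \<Phi> \<mu> = (\<Sum>w\<in>weyl_group \<Phi>. Poly_Mapping.single (w \<mu>) \<lfloor>det (matrix w)\<rfloor>)"

definition bialternant ::
  "(real^'n) set \<Rightarrow> ('i \<Rightarrow> real^'n) \<Rightarrow> 'i set \<Rightarrow> real^'n \<Rightarrow> (real^'n \<Rightarrow>\<^sub>0 int)" where
  "bialternant \<Phi> \<alpha> I \<mu> =
     (THE f. Poly_Mapping.keys f \<subseteq> weight_lattice \<alpha> I \<and>
             alternant \<Phi> (weyl_vector \<alpha> I) * f = alternant \<Phi> (\<mu> + weyl_vector \<alpha> I))"

abbreviation bialternant_sub ::
  "(real^'n) set \<Rightarrow> ('i \<Rightarrow> real^'n) \<Rightarrow> 'i set \<Rightarrow> real^'n \<Rightarrow> (real^'n \<Rightarrow>\<^sub>0 int)" where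
  "bialternant_sub \<Phi> \<alpha> J \<equiv> bialternant (root_subsystem \<Phi> \<alpha> J) \<alpha> J"

text \<open>The coefficient of $\omega_j$ in a weight $\mu$ is \<open>pairing \<alpha> \<mu> j\<close>, the fundamental
  weights being dual to the simple coroots.\<close>

definition restrict_weight :: "('i \<Rightarrow> real^'n) \<Rightarrow> 'i set \<Rightarrow> real^'n \<Rightarrow> real^'n" where
  "restrict_weight \<alpha> J \<mu> = weight_vec \<alpha> J (pairing \<alpha> \<mu>)"

definition restrict_elt ::
  "('i \<Rightarrow> real^'n) \<Rightarrow> 'i set \<Rightarrow> (real^'n \<Rightarrow>\<^sub>0 int) \<Rightarrow> (real^'n \<Rightarrow>\<^sub>0 int)" where
  "restrict_elt \<alpha> J f =
     (\<Sum>\<mu>\<in>Poly_Mapping.keys f.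
        Poly_Mapping.single (restrict_weight \<alpha> J \<mu>) (Poly_Mapping.lookup f \<mu>))"


section \<open>Edge-colored ranked posets\<close>

text \<open>An edge-colored directed graph on a vertex set \<open>R\<close> is given by the relations \<open>E i\<close>:
  \<open>(s, t) \<in> E i\<close> means that there is an edge of color \<open>i\<close> from \<open>s\<close> up to \<open>t\<close>.\<close>

definition covers :: "'x rel \<Rightarrow> 'x rel" where
  "covers le = {(s, t). (s, t) \<in> le \<and> s \<noteq> t \<and>
                  \<not> (\<exists>u. (s, u) \<in> le \<and> (u, t) \<in> le \<and> u \<noteq> s \<and> u \<noteq> t)}"

definition colored_hasse_diagram :: "'i set \<Rightarrow> 'x set \<Rightarrow> ('i \<Rightarrow> 'x rel) \<Rightarrow> bool" where
  "colored_hasse_diagram I R E \<longleftrightarrow>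
     (\<exists>le. partial_order_on R le \<and> (\<Union>i\<in>I. E i) = covers le) \<and>
     (\<forall>i\<in>I. \<forall>j\<in>I. i \<noteq> j \<longrightarrow> E i \<inter> E j = {})"

definition rank_function :: "'x set \<Rightarrow> 'x rel \<Rightarrow> ('x \<Rightarrow> nat) \<Rightarrow> nat \<Rightarrow> bool" where
  "rank_function R D \<rho> l \<longleftrightarrow>
     \<rho> ` R = {0..l} \<and> (\<forall>s\<in>R. \<forall>t\<in>R. (s, t) \<in> D \<longrightarrow> \<rho> s + 1 = \<rho> t)"

text \<open>The empty poset, which admits no surjection onto a set \<open>{0..l}\<close>, is counted as ranked.\<close>

definition ranked :: "'x set \<Rightarrow> 'x rel \<Rightarrow> bool" where
  "ranked R D \<longleftrightarrow> R = {} \<or> (\<exists>\<rho> l. rank_function R D \<rho> l)"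

definition color_comp :: "('i \<Rightarrow> 'x rel) \<Rightarrow> 'i \<Rightarrow> 'x \<Rightarrow> 'x set" where
  "color_comp E i x = {y. (x, y) \<in> (E i \<union> (E i)\<inverse>)\<^sup>*}"

definition comp_rank :: "('i \<Rightarrow> 'x rel) \<Rightarrow> 'i \<Rightarrow> 'x \<Rightarrow> nat" where
  "comp_rank E i x = (THE r. \<exists>\<rho> l. rank_function (color_comp E i x) (E i) \<rho> l \<and> r = \<rho> x)"

definition comp_length :: "('i \<Rightarrow> 'x rel) \<Rightarrow> 'i \<Rightarrow> 'x \<Rightarrow> nat" where
  "comp_length E i x = (THE l. \<exists>\<rho>. rank_function (color_comp E i x) (E i) \<rho> l)"

definition depth :: "('i \<Rightarrow> 'x rel) \<Rightarrow> 'i \<Rightarrow> 'x \<Rightarrow> nat" where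
  "depth E i x = comp_length E i x - comp_rank E i x"

definition wt_coeff :: "('i \<Rightarrow> 'x rel) \<Rightarrow> 'i \<Rightarrow> 'x \<Rightarrow> int" where
  "wt_coeff E i x = int (comp_rank E i x) - int (depth E i x)"

definition wt :: "('i \<Rightarrow> real^'n) \<Rightarrow> 'i set \<Rightarrow> ('i \<Rightarrow> 'x rel) \<Rightarrow> 'x \<Rightarrow> real^'n" where
  "wt \<alpha> J E x = weight_vec \<alpha> J (\<lambda>j. of_int (wt_coeff E j x))"

definition WGF ::
  "('i \<Rightarrow> real^'n) \<Rightarrow> 'i set \<Rightarrow> 'x set \<Rightarrow> ('i \<Rightarrow> 'x rel) \<Rightarrow> (real^'n \<Rightarrow>\<^sub>0 int)" where
  "WGF \<alpha> I R E = (\<Sum>x\<in>R. Poly_Mapping.single (wt \<alpha> I E x) 1)"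

definition Phi_structured_poset ::
  "('i \<Rightarrow> real^'n) \<Rightarrow> 'i set \<Rightarrow> 'x set \<Rightarrow> ('i \<Rightarrow> 'x rel) \<Rightarrow> bool" where
  "Phi_structured_poset \<alpha> I R E \<longleftrightarrow>
     finite R \<and> colored_hasse_diagram I R E \<and> ranked R (\<Union>i\<in>I. E i) \<and>
     (\<forall>i\<in>I. \<forall>(s, t)\<in>E i. wt \<alpha> I E s + \<alpha> i = wt \<alpha> I E t)"

definition fibrous :: "'i set \<Rightarrow> 'x set \<Rightarrow> ('i \<Rightarrow> 'x rel) \<Rightarrow> bool" where
  "fibrous I R E \<longleftrightarrow>
     (\<forall>i\<in>I. \<forall>x\<in>R. \<forall>y\<in>color_comp E i x. \<forall>z\<in>color_comp E i x. (y, z) \<in> (E i)\<^sup>* \<or> (z, y) \<in> (E i)\<^sup>*)"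


section \<open>Colorings and crystalline splitting\<close>

text \<open>Below, \<open>\<nu> :: 'i \<Rightarrow> nat\<close> is the family of coefficients $\nu_j$, $j \in J$, of a dominant weight
  $\sum_{j\in J}\nu_j\omega^J_j$.\<close>

definition M_set :: "'x set \<Rightarrow> ('i \<Rightarrow> 'x rel) \<Rightarrow> 'i set \<Rightarrow> ('i \<Rightarrow> nat) \<Rightarrow> 'x set" where
  "M_set R E J \<nu> = {m\<in>R. \<forall>j\<in>J. depth E j m \<le> \<nu> j}"

definition K_set :: "('i \<Rightarrow> 'x rel) \<Rightarrow> 'i set \<Rightarrow> ('i \<Rightarrow> nat) \<Rightarrow> 'x \<Rightarrow> 'i set" where
  "K_set E J \<nu> x = {j\<in>J. depth E j x > \<nu> j}"

definition marked_elt :: "('i \<Rightarrow> 'x rel) \<Rightarrow> ('i \<Rightarrow> nat) \<Rightarrow> 'x \<Rightarrow> 'i \<Rightarrow> 'x" where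
  "marked_elt E \<nu> x i = (THE y. y \<in> color_comp E i x \<and> depth E i y = \<nu> i + 1)"

text \<open>An element of a chain is among the topmost \<open>1 + p\<close> ones iff fewer than \<open>1 + p\<close> elements lie
  strictly above it.\<close>

definition U_set :: "('i \<Rightarrow> 'x rel) \<Rightarrow> 'i \<Rightarrow> 'x \<Rightarrow> nat \<Rightarrow> 'x set" where
  "U_set E i x p = {y \<in> color_comp E i x. card {z \<in> color_comp E i x. (y, z) \<in> (E i)\<^sup>+} < 1 + p}"

definition J_nu_coloring ::
  "'x set \<Rightarrow> ('i \<Rightarrow> 'x rel) \<Rightarrow> 'i set \<Rightarrow> ('i \<Rightarrow> nat) \<Rightarrow> ('x \<Rightarrow> 'i) \<Rightarrow> bool" where
  "J_nu_coloring R E J \<nu> \<kappa> \<longleftrightarrow>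
     (\<forall>x \<in> R - M_set R E J \<nu>. \<kappa> x \<in> J \<and>
        {y \<in> color_comp E (\<kappa> x) x. y \<notin> M_set R E J \<nu> \<and> \<kappa> y = \<kappa> x}
          = color_comp E (\<kappa> x) x - U_set E (\<kappa> x) x (\<nu> (\<kappa> x)))"

definition crystalline_splitting_poset ::
  "(real^'n) set \<Rightarrow> ('i \<Rightarrow> real^'n) \<Rightarrow> 'i set \<Rightarrow> 'x set \<Rightarrow> ('i \<Rightarrow> 'x rel) \<Rightarrow> bool" where
  "crystalline_splitting_poset \<Phi> \<alpha> I R E \<longleftrightarrow>
     Phi_structured_poset \<alpha> I R E \<and> fibrous I R E \<and>
     (\<forall>J \<nu>. J \<subseteq> I \<and> \<nu> \<in> dominant_weights \<alpha> J \<longrightarrow>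
        (\<exists>S \<subseteq> R.
           (\<forall>s\<in>S. \<nu> + wt \<alpha> J E s \<in> dominant_weights \<alpha> J) \<and>
           bialternant_sub \<Phi> \<alpha> J \<nu> * restrict_elt \<alpha> J (WGF \<alpha> I R E)
             = (\<Sum>s\<in>S. bialternant_sub \<Phi> \<alpha> J (\<nu> + wt \<alpha> J E s))))"


section \<open>Admissible systems\<close>

text \<open>The bijections $\widetilde F_i$ between subsets of \<open>X\<close> are partial maps \<open>F i\<close>; being defined
  at \<open>x\<close> means \<open>x \<in> dom (F i)\<close>.\<close>

definition F_graph :: "('i \<Rightarrow> 'x \<rightharpoonup> 'x) \<Rightarrow> 'i \<Rightarrow> 'x rel" where
  "F_graph F i = {(x, y). F i x = Some y}"

definition F_below :: "('i \<Rightarrow> 'x \<rightharpoonup> 'x) \<Rightarrow> 'i \<Rightarrow> 'x \<Rightarrow> 'x \<Rightarrow> bool" where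
  "F_below F i x y \<longleftrightarrow> (\<exists>k. (y, x) \<in> F_graph F i ^^ k)"

text \<open>Only the values \<open>t x i\<close> with \<open>x \<in> X\<close>, \<open>i \<in> I\<close> and \<open>pairing \<alpha> (dbar x) i < 0\<close> are relevant;
  the others count as undefined. In the last clause \<open>t y j\<close> and \<open>t y' j\<close> are automatically
  defined, since \<open>d < 0\<close>.\<close>

definition coherent_timing_pattern ::
  "('i \<Rightarrow> real^'n) \<Rightarrow> 'i set \<Rightarrow> 'x set \<Rightarrow> ('x \<Rightarrow> real^'n) \<Rightarrow> ('i \<Rightarrow> 'x \<rightharpoonup> 'x)
     \<Rightarrow> ('x \<Rightarrow> 'i \<Rightarrow> real) \<Rightarrow> bool" where
  "coherent_timing_pattern \<alpha> I X dbar F t \<longleftrightarrow>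
     (\<forall>i\<in>I. \<forall>x\<in>X. \<forall>x'. pairing \<alpha> (dbar x) i < 0 \<and> F i x = Some x' \<longrightarrow>
        t x i \<le> t x' i \<and>
        (\<forall>j\<in>I. \<forall>d :: int. \<forall>s :: real. j \<noteq> i \<and> d < 0 \<and> s \<le> t x i \<longrightarrow>
           ((\<exists>y\<in>X. F_below F j x y \<and> pairing \<alpha> (dbar y) j = of_int d \<and> t y j = s) \<longleftrightarrow>
            (\<exists>y'\<in>X. F_below F j x' y' \<and> pairing \<alpha> (dbar y') j = of_int d \<and> t y' j = s))))"

definition admissible_system ::
  "('i \<Rightarrow> real^'n) \<Rightarrow> 'i set \<Rightarrow> 'x set \<Rightarrow> ('x \<Rightarrow> real^'n) \<Rightarrow> ('x \<Rightarrow> real^'n)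
     \<Rightarrow> ('i \<Rightarrow> 'x \<rightharpoonup> 'x) \<Rightarrow> bool" where
  "admissible_system \<alpha> I X \<mu> dbar F \<longleftrightarrow>
     finite X \<and>
     (\<forall>x\<in>X. \<mu> x \<in> weight_lattice \<alpha> I \<and> dbar x \<in> weight_lattice \<alpha> I) \<and>
     (\<forall>x\<in>X. - dbar x \<in> dominant_weights \<alpha> I \<and> \<mu> x - dbar x \<in> dominant_weights \<alpha> I) \<and>
     (\<forall>i\<in>I. dom (F i) = {x\<in>X. pairing \<alpha> (\<mu> x - dbar x) i > 0} \<and>
            ran (F i) = {x\<in>X. pairing \<alpha> (dbar x) i < 0} \<and>
            inj_on (F i) (dom (F i))) \<and>
     (\<forall>i\<in>I. \<forall>x\<in>X. \<forall>x'. F i x = Some x' \<longrightarrow>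
        \<mu> x' = \<mu> x - \<alpha> i \<and> pairing \<alpha> (dbar x') i = pairing \<alpha> (dbar x) i - 1) \<and>
     (\<exists>t. coherent_timing_pattern \<alpha> I X dbar F t)"

definition G_graph :: "('i \<Rightarrow> 'x \<rightharpoonup> 'x) \<Rightarrow> 'i \<Rightarrow> 'x rel" where
  "G_graph F i = {(s, t). F i t = Some s}"

definition least_wrt :: "'i rel \<Rightarrow> 'i set \<Rightarrow> 'i" where
  "least_wrt ord S = (THE i. i \<in> S \<and> (\<forall>j\<in>S. (i, j) \<in> ord))"

definition timing_coloring ::
  "('i \<Rightarrow> 'x rel) \<Rightarrow> 'i rel \<Rightarrow> ('x \<Rightarrow> 'i \<Rightarrow> real) \<Rightarrow> 'i set \<Rightarrow> ('i \<Rightarrow> nat) \<Rightarrow> 'x \<Rightarrow> 'i" where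
  "timing_coloring E ord t J \<nu> x =
     least_wrt ord {i \<in> K_set E J \<nu> x.
       t (marked_elt E \<nu> x i) i = Min ((\<lambda>k. t (marked_elt E \<nu> x k) k) ` K_set E J \<nu> x)}"

end

(* A word in the simple reflections is never shortest if it sends a simple root to a negative one
   (deletion). Hence the stabilizer of rho is trivial and every Weyl group orbit contains exactly one
   dominant vector. This makes alternant(rho) a non-zero-divisor and gives, by elimination along the
   length of mu + rho, the existence of the bialternants.

   In an admissible system the i-strings are chains, and reversing all i-strings shows that the
   weight generating function is invariant. Multiplying the splitting identity with alternant(rho)
   turns it into a sum of the alternants of nu + wt(x) + rho over all x in X, in which the x outside
   of M_set cancel in pairs inside the strings of their own color. Coherence of the timing pattern
   is what makes the color constant along the lower part of such a string: moving x along an edge of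
   color j does not affect what the other colors do up to the time t(x, j). *)
theory Submission
  imports Defs
begin

text \<open>Bialternants are definite descriptions, so existence and uniqueness of the quotient have
  to be established before anything can be computed; afterwards only the equation
  \<open>alternant_mult_bialternant\<close> is used. The inner product with \<open>\<rho>\<close>
  plays several roles: it is positive on simple roots, hence a height that simple reflections raise
  or lower in a controlled way, and on each orbit it is maximal exactly at the dominant vector.
  Coherence speaks of elements above a vertex with prescribed depth and time. At depth
  \<open>\<nu> k + 1\<close> this becomes a statement about the marked element of color
  \<open>k\<close>, which is all the coloring looks at. The cancelling pairing is forced. In
  \<open>\<nu> + wt x + \<rho>\<close> the coefficient at color \<open>i\<close> is
  \<open>\<nu> i + 1 + eps - dep\<close>; the reflection must negate it while
  \<open>eps + dep\<close> is constant on a string, so the new depth is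
  \<open>\<nu> i + 1 + eps\<close>. As \<open>eps\<close> is nonnegative, this exceeds
  \<open>\<nu> i\<close>, and the partner stays in the part of the string that has the same
  color.\<close>

section \<open>Reflections and simple systems\<close>

lemma reflection_alt: "reflection \<beta> v = v - (2 * (v \<bullet> \<beta>) / (\<beta> \<bullet> \<beta>)) *\<^sub>R \<beta>"
  by (simp add: reflection_def coroot_def)

lemma linear_reflection: "linear (reflection \<beta>)"
  by (rule linearI) (simp_all add: reflection_def inner_add_left algebra_simps)

lemma inner_reflection: "reflection \<beta> v \<bullet> reflection \<beta> w = v \<bullet> w"
proof (cases "\<beta> = 0")
  case False
  then have "\<beta> \<bullet> \<beta> \<noteq> 0" by simp
  then show ?thesis
    by (simp add: reflection_alt inner_diff_left inner_diff_right inner_commute field_simps)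
qed (simp add: reflection_alt)

lemma reflection_reflection [simp]: "reflection \<beta> (reflection \<beta> v) = v"
proof (cases "\<beta> = 0")
  case False
  then show ?thesis
    by (simp add: reflection_alt inner_diff_left algebra_simps)
qed (simp add: reflection_alt)

lemma reflection_comp_self [simp]: "reflection \<beta> \<circ> reflection \<beta> = id"
  by (simp add: fun_eq_iff)

lemma reflection_self: "\<beta> \<noteq> 0 \<Longrightarrow> reflection \<beta> \<beta> = - \<beta>"
  by (simp add: reflection_alt scaleR_2)

lemma orthogonal_transformation_reflection: "orthogonal_transformation (reflection \<beta>)"
  by (simp add: orthogonal_transformation_def linear_reflection inner_reflection)

lemma orthogonal_transformation_apply_reflection:
  assumes "orthogonal_transformation f"
  shows "f (reflection \<beta> v) = reflection (f \<beta>) (f v)"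
proof -
  interpret linear f using assms by (simp add: orthogonal_transformation_linear)
  have "f v \<bullet> f w = v \<bullet> w" for v w
    using assms by (simp add: orthogonal_transformation_def)
  then show ?thesis by (simp add: reflection_alt diff scale)
qed

lemma det_matrix_compose_orthogonal:
  assumes "orthogonal_transformation f" "orthogonal_transformation g"
  shows "det (matrix (f \<circ> g)) = det (matrix f) * det (matrix (g :: real^'n \<Rightarrow> real^'n))"
  using assms by (simp add: matrix_compose orthogonal_transformation_linear det_mul)

text \<open>An orthogonal map taking a multiple of a coordinate vector to \<open>\<beta>\<close>
  conjugates the reflection into one with a diagonal matrix. The multiple has the norm of
  \<open>\<beta>\<close>, since only vectors of equal norm are related by orthogonal maps.\<close>

lemma det_reflection:
  fixes \<beta> :: "real^'n"
  assumes "\<beta> \<noteq> 0"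
  shows "det (matrix (reflection \<beta>)) = -1"
proof -
  fix k :: 'n
  define e :: "real^'n" where "e = norm \<beta> *\<^sub>R axis k 1"
  have "norm e = norm \<beta>" by (simp add: e_def)
  then obtain f where f: "orthogonal_transformation f" "f e = \<beta>"
    by (rule orthogonal_transformation_exists)
  have "reflection \<beta> \<circ> f = f \<circ> reflection e"
    using f by (simp add: fun_eq_iff orthogonal_transformation_apply_reflection)
  then have "det (matrix (reflection \<beta>)) * det (matrix f) = det (matrix f) * det (matrix (reflection e))"
    using det_matrix_compose_orthogonal f(1) orthogonal_transformation_reflection by metis
  moreover have "det (matrix f) \<noteq> 0"
    using orthogonal_transformation_det[OF f(1)] by auto
  moreover have "det (matrix (reflection e)) = (\<Prod>i\<in>UNIV. if i = k then -1 else 1)"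
  proof -
    have "matrix (reflection e) $ i $ j = (if i = j then if i = k then -1 else 1 else 0)" for i j
      using assms by (simp add: matrix_def reflection_alt e_def inner_axis_axis) (simp add: axis_def)
    then show ?thesis by (subst det_diagonal) auto
  qed
  ultimately show ?thesis
    using mult_right_cancel[of "det (matrix f)" "det (matrix (reflection \<beta>))" "-1"] by simp
qed

locale based_root_system =
  fixes \<Phi> :: "(real^'n) set" and I :: "'i set" and \<alpha> :: "'i \<Rightarrow> real^'n"
  assumes root_system: "root_system \<Phi>" and simple_roots: "simple_roots \<Phi> I \<alpha>"
begin

abbreviation \<omega> :: "'i \<Rightarrow> real^'n" where "\<omega> \<equiv> fund_weight \<alpha> I"
abbreviation \<rho> :: "real^'n" where "\<rho> \<equiv> weyl_vector \<alpha> I"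
abbreviation \<sigma> :: "'i \<Rightarrow> real^'n \<Rightarrow> real^'n" where "\<sigma> i \<equiv> reflection (\<alpha> i)"

lemma finite_roots: "finite \<Phi>"
  and reflection_root: "\<beta> \<in> \<Phi> \<Longrightarrow> \<gamma> \<in> \<Phi> \<Longrightarrow> reflection \<beta> \<gamma> \<in> \<Phi>"
  and root_nonzero: "\<beta> \<in> \<Phi> \<Longrightarrow> \<beta> \<noteq> 0"
  and root_reduced: "\<beta> \<in> \<Phi> \<Longrightarrow> c *\<^sub>R \<beta> \<in> \<Phi> \<Longrightarrow> c = 1 \<or> c = -1"
  and root_integral: "\<beta> \<in> \<Phi> \<Longrightarrow> \<gamma> \<in> \<Phi> \<Longrightarrow> \<gamma> \<bullet> coroot \<beta> \<in> \<int>"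
  using root_system unfolding root_system_def by blast+

lemma finite_I: "finite I"
  and inj_simple: "inj_on \<alpha> I"
  and simple_in_roots: "i \<in> I \<Longrightarrow> \<alpha> i \<in> \<Phi>"
  and independent_simple: "independent (\<alpha> ` I)"
  and root_cases: "\<beta> \<in> \<Phi> \<Longrightarrow> \<exists>c :: 'i \<Rightarrow> nat.
        \<beta> = (\<Sum>i\<in>I. real (c i) *\<^sub>R \<alpha> i) \<or> \<beta> = - (\<Sum>i\<in>I. real (c i) *\<^sub>R \<alpha> i)"
  using simple_roots unfolding simple_roots_def by blast+

lemma simple_nonzero: "i \<in> I \<Longrightarrow> \<alpha> i \<noteq> 0"
  using root_nonzero simple_in_roots by blast

lemma simple_in_span: "i \<in> I \<Longrightarrow> \<alpha> i \<in> span (\<alpha> ` I)"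
  by (simp add: span_base)

lemma root_in_span: assumes "\<beta> \<in> \<Phi>" shows "\<beta> \<in> span (\<alpha> ` I)"
proof -
  obtain c :: "'i \<Rightarrow> nat" where
    "\<beta> = (\<Sum>i\<in>I. real (c i) *\<^sub>R \<alpha> i) \<or> \<beta> = - (\<Sum>i\<in>I. real (c i) *\<^sub>R \<alpha> i)"
    using root_cases[OF assms] by blast
  moreover have "(\<Sum>i\<in>I. real (c i) *\<^sub>R \<alpha> i) \<in> span (\<alpha> ` I)"
    by (intro span_sum span_scale simple_in_span)
  ultimately show ?thesis by (auto simp: span_neg)
qed

lemma pairing_alt: "pairing \<alpha> v i = 2 * (v \<bullet> \<alpha> i) / (\<alpha> i \<bullet> \<alpha> i)"
  by (simp add: pairing_def coroot_def)

lemma pairing_eq_0_iff: "i \<in> I \<Longrightarrow> pairing \<alpha> v i = 0 \<longleftrightarrow> v \<bullet> \<alpha> i = 0"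
  using simple_nonzero by (simp add: pairing_alt)

lemma simple_reflection: "\<sigma> i v = v - pairing \<alpha> v i *\<^sub>R \<alpha> i"
  by (simp add: reflection_def pairing_def)

lemma pairing_add: "pairing \<alpha> (v + w) i = pairing \<alpha> v i + pairing \<alpha> w i"
  and pairing_diff: "pairing \<alpha> (v - w) i = pairing \<alpha> v i - pairing \<alpha> w i"
  and pairing_minus: "pairing \<alpha> (- v) i = - pairing \<alpha> v i"
  and pairing_scale: "pairing \<alpha> (c *\<^sub>R v) i = c * pairing \<alpha> v i"
  and pairing_sum: "pairing \<alpha> (sum f A) i = (\<Sum>a\<in>A. pairing \<alpha> (f a) i)"
  by (simp_all add: pairing_def inner_add_left inner_diff_left inner_sum_left)

lemma pairing_self: "i \<in> I \<Longrightarrow> pairing \<alpha> (\<alpha> i) i = 2"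
  using simple_nonzero by (simp add: pairing_alt)

text \<open>A vector of the span that is orthogonal to every simple root is orthogonal to itself.
  Many identities between weights below are proved by this coordinate test.\<close>

lemma span_eqI:
  assumes "v \<in> span (\<alpha> ` I)" "w \<in> span (\<alpha> ` I)" "\<And>k. k \<in> I \<Longrightarrow> pairing \<alpha> v k = pairing \<alpha> w k"
  shows "v = w"
proof -
  have "(v - w) \<bullet> \<alpha> k = 0" if "k \<in> I" for k
    using assms(3)[OF that] pairing_eq_0_iff[OF that, of "v - w"] by (simp add: pairing_diff)
  then have "orthogonal (v - w) (v - w)"
    by (intro orthogonal_to_span[OF span_diff[OF assms(1,2)], of "v - w"]) (auto simp: orthogonal_def)
  then show ?thesis by (simp add: orthogonal_def)
qed

text \<open>The part \<open>z\<close> of \<open>\<alpha> j\<close> orthogonal to all other simple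
  roots is nonzero by independence; rescaling it gives the dual vector.\<close>

lemma dual_exists:
  assumes "j \<in> I"
  shows "\<exists>w. w \<in> span (\<alpha> ` I) \<and> (\<forall>k\<in>I. pairing \<alpha> w k = (if k = j then 1 else 0))"
proof -
  let ?S = "\<alpha> ` (I - {j})"
  obtain y z where yz: "y \<in> span ?S" "\<And>w. w \<in> span ?S \<Longrightarrow> orthogonal z w" "\<alpha> j = y + z"
    using orthogonal_subspace_decomp_exists[of ?S "\<alpha> j"] by blast
  have "\<alpha> ` I - {\<alpha> j} = ?S"
    using inj_simple assms by (auto simp: inj_on_def)
  then have "\<alpha> j \<notin> span ?S"
    using independent_simple assms unfolding dependent_def by auto
  then have "z \<noteq> 0" using yz by auto
  have "span ?S \<subseteq> span (\<alpha> ` I)" by (rule span_mono) auto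
  then have z: "z \<in> span (\<alpha> ` I)"
    using span_diff[OF simple_in_span[OF assms], of y] yz by auto
  have zz: "z \<bullet> \<alpha> j = z \<bullet> z"
    using yz(2)[OF yz(1)] by (simp add: yz(3) orthogonal_def inner_add_right)
  have z0: "z \<bullet> \<alpha> k = 0" if "k \<in> I" "k \<noteq> j" for k
    using yz(2)[of "\<alpha> k"] that by (auto simp: orthogonal_def span_base)
  have "pairing \<alpha> z j \<noteq> 0" using \<open>z \<noteq> 0\<close> zz assms by (simp add: pairing_eq_0_iff)
  then show ?thesis
    using z z0 assms
    by (intro exI[of _ "(1 / pairing \<alpha> z j) *\<^sub>R z"])
       (auto simp: span_scale pairing_scale pairing_eq_0_iff)
qed

lemma fund_weight_span: "j \<in> I \<Longrightarrow> \<omega> j \<in> span (\<alpha> ` I)"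
  and pairing_fund_weight: "j \<in> I \<Longrightarrow> k \<in> I \<Longrightarrow> pairing \<alpha> (\<omega> j) k = (if k = j then 1 else 0)"
proof -
  have "\<omega> j \<in> span (\<alpha> ` I) \<and> (\<forall>k\<in>I. pairing \<alpha> (\<omega> j) k = (if k = j then 1 else 0))" if "j \<in> I"
    unfolding fund_weight_def
  proof (rule theI', rule ex_ex1I)
    show "w = w'"
      if "w \<in> span (\<alpha> ` I) \<and> (\<forall>k\<in>I. pairing \<alpha> w k = (if k = j then 1 else 0))"
        and "w' \<in> span (\<alpha> ` I) \<and> (\<forall>k\<in>I. pairing \<alpha> w' k = (if k = j then 1 else 0))" for w w'
      using that by (intro span_eqI) simp_all
  qed (rule dual_exists[OF that])
  then show "j \<in> I \<Longrightarrow> \<omega> j \<in> span (\<alpha> ` I)"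
    and "j \<in> I \<Longrightarrow> k \<in> I \<Longrightarrow> pairing \<alpha> (\<omega> j) k = (if k = j then 1 else 0)" by blast+
qed

lemma weight_vec_span: "weight_vec \<alpha> I c \<in> span (\<alpha> ` I)"
  unfolding weight_vec_def by (intro span_sum span_scale fund_weight_span)

lemma pairing_weight_vec: "k \<in> I \<Longrightarrow> pairing \<alpha> (weight_vec \<alpha> I c) k = c k"
  using finite_I
  by (simp add: weight_vec_def pairing_sum pairing_scale pairing_fund_weight if_distrib sum.delta cong: if_cong)

lemma weight_vec_pairing: "v \<in> span (\<alpha> ` I) \<Longrightarrow> weight_vec \<alpha> I (pairing \<alpha> v) = v"
  by (intro span_eqI weight_vec_span) (auto simp: pairing_weight_vec)

lemma weyl_vector_span: "\<rho> \<in> span (\<alpha> ` I)"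
  unfolding weyl_vector_def by (intro span_sum fund_weight_span)

lemma pairing_weyl_vector: "k \<in> I \<Longrightarrow> pairing \<alpha> \<rho> k = 1"
  using finite_I
  by (simp add: weyl_vector_def pairing_sum pairing_fund_weight)

text \<open>A form without coordinates, in which closure under sums and reflections can be checked
  one pairing at a time.\<close>

lemma weight_lattice_iff:
  "v \<in> weight_lattice \<alpha> I \<longleftrightarrow> v \<in> span (\<alpha> ` I) \<and> (\<forall>k\<in>I. pairing \<alpha> v k \<in> \<int>)" (is "?L \<longleftrightarrow> ?R")
proof
  assume ?L
  then show ?R by (auto simp: weight_lattice_def weight_vec_span pairing_weight_vec)
next
  assume R: ?R
  then have "v = weight_vec \<alpha> I (\<lambda>k. of_int \<lfloor>pairing \<alpha> v k\<rfloor>)"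
    by (intro span_eqI) (auto simp: weight_vec_span pairing_weight_vec)
  moreover have "weight_vec \<alpha> I (\<lambda>k. of_int \<lfloor>pairing \<alpha> v k\<rfloor>) \<in> weight_lattice \<alpha> I"
    by (auto simp: weight_lattice_def)
  ultimately show ?L by (rule ssubst)
qed

lemma dominant_weights_iff:
  "v \<in> dominant_weights \<alpha> I \<longleftrightarrow> v \<in> weight_lattice \<alpha> I \<and> (\<forall>k\<in>I. pairing \<alpha> v k \<ge> 0)" (is "?L \<longleftrightarrow> ?R")
proof
  assume ?L
  then show ?R by (auto simp: weight_lattice_iff dominant_weights_def weight_vec_span pairing_weight_vec)
next
  assume R: ?R
  then have "v = weight_vec \<alpha> I (\<lambda>k. of_nat (nat \<lfloor>pairing \<alpha> v k\<rfloor>))"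
    by (intro span_eqI) (auto simp: weight_vec_span pairing_weight_vec weight_lattice_iff)
  moreover have "weight_vec \<alpha> I (\<lambda>k. of_nat (nat \<lfloor>pairing \<alpha> v k\<rfloor>)) \<in> dominant_weights \<alpha> I"
    by (force simp: dominant_weights_def)
  ultimately show ?L by (rule ssubst)
qed

lemma weight_lattice_add: "v \<in> weight_lattice \<alpha> I \<Longrightarrow> w \<in> weight_lattice \<alpha> I \<Longrightarrow> v + w \<in> weight_lattice \<alpha> I"
  and weight_lattice_diff: "v \<in> weight_lattice \<alpha> I \<Longrightarrow> w \<in> weight_lattice \<alpha> I \<Longrightarrow> v - w \<in> weight_lattice \<alpha> I"
  by (auto simp: weight_lattice_iff span_add span_diff pairing_add pairing_diff)

lemma weyl_vector_lattice: "\<rho> \<in> weight_lattice \<alpha> I"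
  by (simp add: weight_lattice_iff weyl_vector_span pairing_weyl_vector)

lemma simple_in_lattice: "i \<in> I \<Longrightarrow> \<alpha> i \<in> weight_lattice \<alpha> I"
  using simple_in_span root_integral simple_in_roots
  by (simp add: weight_lattice_iff pairing_def)

end

text \<open>This makes the whole theory available for each \<open>J\<close>. The point that needs an
  argument is that a root in the span of the \<open>J\<close>-roots involves no other simple root:
  \<open>\<omega> i\<close> with \<open>i\<close> outside \<open>J\<close> is orthogonal to that
  span, and its product with the root isolates the coefficient \<open>c i\<close>.\<close>

lemma based_root_system_subsystem:
  fixes \<alpha> :: "'i \<Rightarrow> real^'n"
  assumes "based_root_system \<Phi> I \<alpha>" and "J \<subseteq> I"
  shows "based_root_system (root_subsystem \<Phi> \<alpha> J) J \<alpha>"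
proof -
  interpret based_root_system \<Phi> I \<alpha> by fact
  have refl: "reflection \<beta> \<gamma> \<in> root_subsystem \<Phi> \<alpha> J"
    if "\<beta> \<in> root_subsystem \<Phi> \<alpha> J" "\<gamma> \<in> root_subsystem \<Phi> \<alpha> J" for \<beta> \<gamma>
    using that reflection_root
    by (auto simp: root_subsystem_def reflection_def intro!: span_diff span_scale)
  have "reflection \<beta> ` root_subsystem \<Phi> \<alpha> J = root_subsystem \<Phi> \<alpha> J"
    if "\<beta> \<in> root_subsystem \<Phi> \<alpha> J" for \<beta>
  proof (rule antisym)
    show "root_subsystem \<Phi> \<alpha> J \<subseteq> reflection \<beta> ` root_subsystem \<Phi> \<alpha> J"
    proof
      fix \<gamma> assume "\<gamma> \<in> root_subsystem \<Phi> \<alpha> J"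
      then have "reflection \<beta> \<gamma> \<in> root_subsystem \<Phi> \<alpha> J" by (rule refl[OF that])
      then show "\<gamma> \<in> reflection \<beta> ` root_subsystem \<Phi> \<alpha> J"
        by (rule rev_image_eqI) simp
    qed
  qed (use refl[OF that] in blast)
  then have "root_system (root_subsystem \<Phi> \<alpha> J)"
    using finite_roots root_nonzero root_reduced root_integral
    unfolding root_system_def by (simp add: root_subsystem_def) blast
  moreover have "\<exists>c :: 'i \<Rightarrow> nat. \<beta> = (\<Sum>i\<in>J. real (c i) *\<^sub>R \<alpha> i) \<or> \<beta> = - (\<Sum>i\<in>J. real (c i) *\<^sub>R \<alpha> i)"
    if "\<beta> \<in> root_subsystem \<Phi> \<alpha> J" for \<beta>
  proof -
    have \<beta>: "\<beta> \<in> \<Phi>" "\<beta> \<in> span (\<alpha> ` J)" using that by (auto simp: root_subsystem_def)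
    obtain c :: "'i \<Rightarrow> nat" and e :: real where c: "\<beta> = e *\<^sub>R (\<Sum>i\<in>I. real (c i) *\<^sub>R \<alpha> i)" "e = 1 \<or> e = -1"
      using root_cases[OF \<beta>(1)] by (metis scaleR_minus1_left scaleR_one)
    have orth: "\<omega> i \<bullet> \<alpha> k = 0" if "i \<in> I" "k \<in> I" "k \<noteq> i" for i k
      using pairing_fund_weight[of i k] that by (simp add: pairing_eq_0_iff)
    have "c i = 0" if i: "i \<in> I - J" for i
    proof -
      have "orthogonal (\<omega> i) \<beta>"
        by (rule orthogonal_to_span[OF \<beta>(2)])
           (use i assms(2) orth in \<open>auto simp: orthogonal_def\<close>)
      then have "(\<Sum>k\<in>I. real (c k) * (\<omega> i \<bullet> \<alpha> k)) = 0"
        using c by (auto simp: orthogonal_def inner_sum_right)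
      moreover have "(\<Sum>k\<in>I. real (c k) * (\<omega> i \<bullet> \<alpha> k)) = (\<Sum>k\<in>I. if k = i then real (c i) * (\<omega> i \<bullet> \<alpha> i) else 0)"
        using i orth by (intro sum.cong) auto
      moreover have "\<omega> i \<bullet> \<alpha> i \<noteq> 0"
        using i pairing_fund_weight[of i i] pairing_eq_0_iff[of i "\<omega> i"] by auto
      ultimately show ?thesis using i finite_I by (simp add: sum.delta)
    qed
    then have "(\<Sum>i\<in>I. real (c i) *\<^sub>R \<alpha> i) = (\<Sum>i\<in>J. real (c i) *\<^sub>R \<alpha> i)"
      using assms(2) finite_I by (intro sum.mono_neutral_right) auto
    then show ?thesis using c by auto
  qed
  moreover have "finite J" "inj_on \<alpha> J" "independent (\<alpha> ` J)" "\<alpha> ` J \<subseteq> root_subsystem \<Phi> \<alpha> J"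
    using assms(2) finite_I inj_simple independent_mono[OF independent_simple, of "\<alpha> ` J"] simple_in_roots
    by (auto simp: root_subsystem_def span_base intro: finite_subset inj_on_subset)
  ultimately show ?thesis
    by (simp add: based_root_system_def simple_roots_def)
qed

section \<open>The Weyl group\<close>

context based_root_system
begin

section \<open>Positive roots and dominant vectors\<close>

lemma inner_simple_fund_weight:
  "i \<in> I \<Longrightarrow> k \<in> I \<Longrightarrow> \<alpha> k \<bullet> \<omega> i = (if k = i then (\<alpha> i \<bullet> \<alpha> i) / 2 else 0)"
  using pairing_fund_weight[of i k] simple_nonzero[of k]
  by (auto simp: pairing_alt inner_commute field_simps split: if_splits)

lemma inner_simple_weyl_vector: "i \<in> I \<Longrightarrow> \<alpha> i \<bullet> \<rho> > 0"
  using pairing_weyl_vector[of i] simple_nonzero[of i] inner_gt_zero_iff[of "\<alpha> i"]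
  by (simp add: pairing_alt inner_commute field_simps del: inner_gt_zero_iff)

lemma span_eq_0I:
  assumes "v \<in> span (\<alpha> ` I)" "\<And>i. i \<in> I \<Longrightarrow> v \<bullet> \<omega> i = 0"
  shows "v = 0"
proof -
  have "v \<bullet> weight_vec \<alpha> I (pairing \<alpha> v) = 0"
    using assms(2) by (simp add: weight_vec_def inner_sum_right)
  then show ?thesis using assms(1) by (simp add: weight_vec_pairing)
qed

text \<open>The fundamental weights are dual to the simple roots up to the factors
  \<open>(\<alpha> k \<bullet> \<alpha> k) / 2\<close>, so products with them read off the
  coefficients.\<close>

lemma simple_expansion:
  assumes "v \<in> span (\<alpha> ` I)"
  shows "v = (\<Sum>k\<in>I. (2 * (v \<bullet> \<omega> k) / (\<alpha> k \<bullet> \<alpha> k)) *\<^sub>R \<alpha> k)" (is "v = ?S")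
proof -
  have "(v - ?S) \<bullet> \<omega> i = 0" if i: "i \<in> I" for i
  proof -
    have "?S \<bullet> \<omega> i = (\<Sum>k\<in>I. if k = i then v \<bullet> \<omega> i else 0)"
      unfolding inner_sum_left using i simple_nonzero
      by (intro sum.cong) (auto simp: inner_simple_fund_weight)
    then show ?thesis using i finite_I by (simp add: inner_diff_left)
  qed
  moreover have "v - ?S \<in> span (\<alpha> ` I)"
    using assms by (intro span_diff span_sum span_scale simple_in_span)
  ultimately show ?thesis using span_eq_0I[of "v - ?S"] by simp
qed

text \<open>By \<open>simple_expansion\<close> these products are the simple-root coefficients up to
  positive factors, so this is the usual positivity without choosing an expansion.\<close>

definition pos :: "real^'n \<Rightarrow> bool" where
  "pos \<beta> \<longleftrightarrow> \<beta> \<in> \<Phi> \<and> (\<forall>i\<in>I. 0 \<le> \<beta> \<bullet> \<omega> i)"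

definition dominant :: "real^'n \<Rightarrow> bool" where
  "dominant v \<longleftrightarrow> (\<forall>k\<in>I. 0 \<le> v \<bullet> \<alpha> k)"

definition regular_dominant :: "real^'n \<Rightarrow> bool" where
  "regular_dominant v \<longleftrightarrow> (\<forall>k\<in>I. 0 < v \<bullet> \<alpha> k)"

lemma posD: "pos \<beta> \<Longrightarrow> \<beta> \<in> \<Phi>" "pos \<beta> \<Longrightarrow> i \<in> I \<Longrightarrow> 0 \<le> \<beta> \<bullet> \<omega> i"
  by (auto simp: pos_def)

lemma minus_root: "\<beta> \<in> \<Phi> \<Longrightarrow> - \<beta> \<in> \<Phi>"
  using reflection_root[of \<beta> \<beta>] root_nonzero[of \<beta>] by (simp add: reflection_self)

lemma pos_or_neg:
  assumes "\<beta> \<in> \<Phi>" shows "pos \<beta> \<or> pos (- \<beta>)"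
proof -
  obtain c :: "'i \<Rightarrow> nat" where
    c: "\<beta> = (\<Sum>i\<in>I. real (c i) *\<^sub>R \<alpha> i) \<or> \<beta> = - (\<Sum>i\<in>I. real (c i) *\<^sub>R \<alpha> i)"
    using root_cases[OF assms] by blast
  have "0 \<le> (\<Sum>i\<in>I. real (c i) *\<^sub>R \<alpha> i) \<bullet> \<omega> k" if "k \<in> I" for k
    using that by (simp add: inner_sum_left inner_simple_fund_weight sum_nonneg)
  then show ?thesis using c assms minus_root[OF assms] by (auto simp: pos_def)
qed

lemma not_pos_and_neg:
  assumes "pos \<beta>" shows "\<not> pos (- \<beta>)"
proof
  assume "pos (- \<beta>)"
  then have "\<beta> \<bullet> \<omega> i = 0" if "i \<in> I" for i
    using posD(2)[OF assms that] posD(2)[OF _ that, of "- \<beta>"] by simp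
  then have "\<beta> = 0" using span_eq_0I[OF root_in_span] assms by (simp add: pos_def)
  then show False using assms root_nonzero by (auto simp: pos_def)
qed

lemma pos_simple: "i \<in> I \<Longrightarrow> pos (\<alpha> i)"
  using simple_in_roots by (auto simp: pos_def inner_simple_fund_weight)

text \<open>A simple reflection alters only the coefficient at its own root. If the image is
  negative, all other coefficients of \<open>\<beta>\<close> vanish, and a positive root
  proportional to \<open>\<alpha> i\<close> is \<open>\<alpha> i\<close> because the system is
  reduced.\<close>

lemma pos_simple_reflection:
  assumes "pos \<beta>" "i \<in> I" "\<beta> \<noteq> \<alpha> i"
  shows "pos (\<sigma> i \<beta>)"
proof (rule ccontr)
  assume "\<not> pos (\<sigma> i \<beta>)"
  moreover have "\<sigma> i \<beta> \<in> \<Phi>" using assms by (simp add: reflection_root simple_in_roots posD)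
  ultimately have neg: "pos (- \<sigma> i \<beta>)" using pos_or_neg by blast
  have 0: "\<beta> \<bullet> \<omega> k = 0" if "k \<in> I" "k \<noteq> i" for k
    using posD(2)[OF neg that(1)] posD(2)[OF assms(1) that(1)] that assms(2)
    by (simp add: simple_reflection inner_diff_left inner_simple_fund_weight)
  have "\<beta> = (\<Sum>k\<in>I. (2 * (\<beta> \<bullet> \<omega> k) / (\<alpha> k \<bullet> \<alpha> k)) *\<^sub>R \<alpha> k)"
    using assms(1) by (intro simple_expansion root_in_span posD)
  also have "\<dots> = (\<Sum>k\<in>I. if k = i then (2 * (\<beta> \<bullet> \<omega> i) / (\<alpha> i \<bullet> \<alpha> i)) *\<^sub>R \<alpha> i else 0)"
    using 0 by (intro sum.cong) auto
  finally have eq: "\<beta> = (2 * (\<beta> \<bullet> \<omega> i) / (\<alpha> i \<bullet> \<alpha> i)) *\<^sub>R \<alpha> i" (is "_ = ?c *\<^sub>R _")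
    using assms(2) finite_I by simp
  have "?c = 1 \<or> ?c = -1"
    using root_reduced[OF simple_in_roots[OF assms(2)]] eq posD(1)[OF assms(1)] by metis
  moreover have "?c \<ge> 0" using posD(2)[OF assms(1,2)] by simp
  ultimately have "?c = 1" by linarith
  then show False using eq assms(3) by (metis scaleR_one)
qed

lemma inner_dominant_pos:
  assumes "dominant v" "pos \<beta>" shows "0 \<le> v \<bullet> \<beta>"
proof -
  have "v \<bullet> \<beta> = (\<Sum>k\<in>I. (2 * (\<beta> \<bullet> \<omega> k) / (\<alpha> k \<bullet> \<alpha> k)) * (v \<bullet> \<alpha> k))"
    by (subst simple_expansion[OF root_in_span[OF posD(1)[OF assms(2)]]]) (simp add: inner_sum_right)
  also have "\<dots> \<ge> 0"
    using assms by (intro sum_nonneg mult_nonneg_nonneg divide_nonneg_nonneg) (auto simp: dominant_def posD)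
  finally show ?thesis .
qed

text \<open>Otherwise \<open>- \<beta>\<close> would be dominant and its product with the positive
  root \<open>\<beta>\<close> nonnegative.\<close>

lemma exists_simple_inner_pos:
  assumes "pos \<beta>" shows "\<exists>i\<in>I. 0 < \<beta> \<bullet> \<alpha> i"
proof (rule ccontr)
  assume "\<not> ?thesis"
  then have "dominant (- \<beta>)" by (auto simp: dominant_def not_less)
  then have "\<beta> \<bullet> \<beta> \<le> 0" using inner_dominant_pos[OF _ assms] by fastforce
  then show False using root_nonzero[OF posD(1)[OF assms]] inner_gt_zero_iff[of \<beta>] by linarith
qed

lemma inner_regular_dominant_pos:
  assumes "regular_dominant v" "pos \<beta>" shows "0 < v \<bullet> \<beta>"
proof -
  have eq: "v \<bullet> \<beta> = (\<Sum>k\<in>I. (2 * (\<beta> \<bullet> \<omega> k) / (\<alpha> k \<bullet> \<alpha> k)) * (v \<bullet> \<alpha> k))"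
    by (subst simple_expansion[OF root_in_span[OF posD(1)[OF assms(2)]]]) (simp add: inner_sum_right)
  obtain k where k: "k \<in> I" "\<beta> \<bullet> \<omega> k \<noteq> 0"
    using span_eq_0I[OF root_in_span[OF posD(1)[OF assms(2)]]] root_nonzero[OF posD(1)[OF assms(2)]]
    by blast
  have "0 < (\<Sum>k\<in>I. (2 * (\<beta> \<bullet> \<omega> k) / (\<alpha> k \<bullet> \<alpha> k)) * (v \<bullet> \<alpha> k))"
  proof (rule sum_pos2[OF finite_I k(1)])
    have "0 < \<beta> \<bullet> \<omega> k" "0 < v \<bullet> \<alpha> k" "0 < \<alpha> k \<bullet> \<alpha> k"
      using k posD(2)[OF assms(2) k(1)] assms(1) simple_nonzero[OF k(1)]
      by (auto simp: regular_dominant_def)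
    then show "0 < 2 * (\<beta> \<bullet> \<omega> k) / (\<alpha> k \<bullet> \<alpha> k) * (v \<bullet> \<alpha> k)" by simp
    show "0 \<le> 2 * (\<beta> \<bullet> \<omega> j) / (\<alpha> j \<bullet> \<alpha> j) * (v \<bullet> \<alpha> j)" if "j \<in> I" for j
      using that assms posD(2)[OF assms(2) that]
      by (intro mult_nonneg_nonneg divide_nonneg_nonneg) (auto simp: regular_dominant_def less_imp_le)
  qed
  then show ?thesis by (simp only: eq)
qed

text \<open>\<open>weyl_group\<close> is generated by all root reflections; the inductions below
  need expressions in simple reflections and their length.\<close>

primrec word :: "'i list \<Rightarrow> real^'n \<Rightarrow> real^'n" where
  "word [] = id"
| "word (i # xs) = \<sigma> i \<circ> word xs"

lemma word_append: "word (xs @ ys) = word xs \<circ> word ys"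
  by (induction xs) (simp_all add: o_assoc)

lemma word_rev_word [simp]: "word (rev xs) (word xs v) = v"
  by (induction xs arbitrary: v) (simp_all add: word_append)

lemma word_word_rev [simp]: "word xs (word (rev xs) v) = v"
  using word_rev_word[of "rev xs"] by simp

lemma orthogonal_transformation_word: "orthogonal_transformation (word xs)"
proof (induction xs)
  case (Cons i xs)
  then show ?case
    unfolding word.simps
    by (intro orthogonal_transformation_compose orthogonal_transformation_reflection)
qed (simp add: id_def)

lemma inner_word: "word xs v \<bullet> word xs w = v \<bullet> w"
  using orthogonal_transformation_word by (simp add: orthogonal_transformation_def)

lemma word_root: "set xs \<subseteq> I \<Longrightarrow> \<beta> \<in> \<Phi> \<Longrightarrow> word xs \<beta> \<in> \<Phi>"
  by (induction xs) (simp_all add: reflection_root simple_in_roots)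

text \<open>The reflection subtracts a multiple of \<open>\<alpha> i\<close> whose sign is that of
  \<open>v \<bullet> \<alpha> i\<close>, and \<open>\<alpha> i\<close> has positive product with
  \<open>\<rho>\<close>.\<close>

lemma inner_weyl_vector_simple_reflection:
  assumes "i \<in> I" shows "\<sigma> i v \<bullet> \<rho> < v \<bullet> \<rho> \<longleftrightarrow> 0 < v \<bullet> \<alpha> i"
    and "\<sigma> i v \<bullet> \<rho> \<le> v \<bullet> \<rho> \<longleftrightarrow> 0 \<le> v \<bullet> \<alpha> i"
proof -
  have "0 < \<alpha> i \<bullet> \<rho>" "0 < \<alpha> i \<bullet> \<alpha> i"
    using inner_simple_weyl_vector[OF assms] simple_nonzero[OF assms] by simp_all
  then show "\<sigma> i v \<bullet> \<rho> < v \<bullet> \<rho> \<longleftrightarrow> 0 < v \<bullet> \<alpha> i" "\<sigma> i v \<bullet> \<rho> \<le> v \<bullet> \<rho> \<longleftrightarrow> 0 \<le> v \<bullet> \<alpha> i"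
    unfolding simple_reflection inner_diff_left inner_scaleR_left pairing_alt
    by (simp_all add: zero_less_mult_iff zero_le_mult_iff zero_less_divide_iff
        zero_le_divide_iff divide_less_0_iff mult_less_0_iff not_less[symmetric] del: inner_gt_zero_iff)
qed

text \<open>In the orbit of a positive root, a positive element of least height is simple.\<close>

lemma reflection_eq_word:
  assumes "\<beta> \<in> \<Phi>" shows "\<exists>xs. set xs \<subseteq> I \<and> reflection \<beta> = word xs"
proof -
  have main: "\<exists>xs. set xs \<subseteq> I \<and> reflection \<beta> = word xs" if "pos \<beta>" for \<beta>
  proof -
    define A where "A = {\<gamma>. pos \<gamma> \<and> (\<exists>xs. set xs \<subseteq> I \<and> \<gamma> = word xs \<beta>)}"
    have "A \<subseteq> \<Phi>" by (auto simp: A_def posD)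
    then have "finite A" by (rule finite_subset) (rule finite_roots)
    moreover have "word [] \<beta> \<in> A" using that unfolding A_def
      by (intro CollectI conjI exI[of _ "[]"]) simp_all
    ultimately obtain \<gamma> where \<gamma>: "\<gamma> \<in> A" "\<And>\<delta>. \<delta> \<in> A \<Longrightarrow> \<gamma> \<bullet> \<rho> \<le> \<delta> \<bullet> \<rho>"
      using arg_min_if_finite[of A "\<lambda>\<gamma>. \<gamma> \<bullet> \<rho>"] by (metis empty_iff not_less)
    then obtain xs where xs: "pos \<gamma>" "set xs \<subseteq> I" "\<gamma> = word xs \<beta>" by (auto simp: A_def)
    obtain i where i: "i \<in> I" "0 < \<gamma> \<bullet> \<alpha> i" using exists_simple_inner_pos[OF xs(1)] by blast
    have "\<gamma> = \<alpha> i"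
    proof (rule ccontr)
      assume "\<gamma> \<noteq> \<alpha> i"
      then have "\<sigma> i \<gamma> \<in> A"
        unfolding A_def using xs i(1) pos_simple_reflection[OF xs(1) i(1)]
        by (intro CollectI conjI exI[of _ "i # xs"]) simp_all
      from \<gamma>(2)[OF this] show False
        using i inner_weyl_vector_simple_reflection(1)[OF i(1), of \<gamma>] by simp
    qed
    \<comment> \<open>The word \<open>xs\<close> carries \<open>\<beta>\<close> to
      \<open>\<alpha> i\<close>, hence conjugates the reflection along \<open>\<beta>\<close> to
      \<open>\<sigma> i\<close>; reversed words are inverses.\<close>
    have "reflection \<beta> v = word (rev xs @ [i] @ xs) v" for v
    proof -
      have "word xs (reflection \<beta> v) = \<sigma> i (word xs v)"
        using orthogonal_transformation_apply_reflection[OF orthogonal_transformation_word, of xs \<beta> v]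
          \<open>\<gamma> = \<alpha> i\<close> xs(3) by simp
      then have "word (rev xs) (word xs (reflection \<beta> v)) = word (rev xs) (\<sigma> i (word xs v))" by simp
      then show ?thesis by (simp add: word_append)
    qed
    then show ?thesis using xs(2) i(1) by (intro exI[of _ "rev xs @ [i] @ xs"]) auto
  qed
  have "reflection (- \<beta>) = reflection \<beta>" by (simp add: fun_eq_iff reflection_alt)
  then show ?thesis using main[of \<beta>] main[of "- \<beta>"] pos_or_neg[OF assms] by auto
qed

section \<open>The Weyl group in terms of words, and its finiteness\<close>

abbreviation W :: "(real^'n \<Rightarrow> real^'n) set" where "W \<equiv> weyl_group \<Phi>"

lemma weyl_group_word: "w \<in> W \<Longrightarrow> \<exists>xs. set xs \<subseteq> I \<and> w = word xs"
proof (induction rule: weyl_group.induct)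
  case weyl_id
  show ?case by (intro exI[of _ "[]"]) simp
next
  case (weyl_reflection \<beta> w)
  then obtain xs ys where "set xs \<subseteq> I" "w = word xs" "set ys \<subseteq> I" "reflection \<beta> = word ys"
    using reflection_eq_word by blast
  then show ?case by (intro exI[of _ "ys @ xs"]) (simp add: word_append)
qed

lemma word_in_weyl_group: "set xs \<subseteq> I \<Longrightarrow> word xs \<in> W"
  by (induction xs) (auto intro: weyl_group.intros simp: simple_in_roots simp del: id_apply)

lemma weyl_group_comp: "w \<in> W \<Longrightarrow> w' \<in> W \<Longrightarrow> w \<circ> w' \<in> W"
  by (induction rule: weyl_group.induct) (auto intro: weyl_group.intros simp: comp_assoc)

lemma simple_reflection_in_weyl_group: "i \<in> I \<Longrightarrow> \<sigma> i \<in> W"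
  using word_in_weyl_group[of "[i]"] by simp

lemma weyl_group_inverse:
  assumes "w \<in> W" obtains w' where "w' \<in> W" "w' \<circ> w = id" "w \<circ> w' = id"
proof -
  obtain xs where xs: "set xs \<subseteq> I" "w = word xs" using weyl_group_word[OF assms] by blast
  then have "word (rev xs) \<in> W" by (simp add: word_in_weyl_group)
  with xs show ?thesis by (intro that[of "word (rev xs)"]) (simp_all add: fun_eq_iff)
qed

lemma orthogonal_transformation_weyl_group: "w \<in> W \<Longrightarrow> orthogonal_transformation w"
  using weyl_group_word orthogonal_transformation_word by blast

lemma inner_weyl_group: "w \<in> W \<Longrightarrow> w v \<bullet> w u = v \<bullet> u"
  using orthogonal_transformation_weyl_group by (simp add: orthogonal_transformation_def)

lemma linear_weyl_group: "w \<in> W \<Longrightarrow> linear w"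
  by (simp add: orthogonal_transformation_weyl_group orthogonal_transformation_linear)

lemma weyl_group_lattice:
  assumes "w \<in> W" "v \<in> weight_lattice \<alpha> I" shows "w v \<in> weight_lattice \<alpha> I"
proof -
  have step: "\<sigma> i v \<in> weight_lattice \<alpha> I" if "i \<in> I" "v \<in> weight_lattice \<alpha> I" for i v
  proof -
    have "pairing \<alpha> v i *\<^sub>R \<alpha> i \<in> weight_lattice \<alpha> I"
      using that simple_in_lattice[OF that(1)] by (auto simp: weight_lattice_iff span_scale pairing_scale)
    then show ?thesis unfolding simple_reflection using that(2) by (rule weight_lattice_diff[rotated])
  qed
  have "set xs \<subseteq> I \<Longrightarrow> word xs v \<in> weight_lattice \<alpha> I" for xs
    using assms(2) by (induction xs) (simp_all add: step)
  then show ?thesis using weyl_group_word[OF assms(1)] by auto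
qed

text \<open>An element is determined by its action on the roots: linearity fixes it on their span,
  and on the orthogonal complement every word acts as the identity. So the group embeds into the
  self-maps of a finite set.\<close>

lemma finite_weyl_group: "finite W"
proof (rule finite_imageD)
  have "(\<lambda>w. restrict w \<Phi>) ` W \<subseteq> PiE \<Phi> (\<lambda>_. \<Phi>)"
    using weyl_group_word word_root by fastforce
  then show "finite ((\<lambda>w. restrict w \<Phi>) ` W)"
    by (rule finite_subset) (simp add: finite_PiE finite_roots)
  show "inj_on (\<lambda>w. restrict w \<Phi>) W"
  proof (rule inj_onI, rule ext)
    fix w w' v assume w: "w \<in> W" "w' \<in> W" and eq: "restrict w \<Phi> = restrict w' \<Phi>"
    obtain y z where yz: "y \<in> span (\<alpha> ` I)" "\<And>u. u \<in> span (\<alpha> ` I) \<Longrightarrow> orthogonal z u" "v = y + z"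
      using orthogonal_subspace_decomp_exists[of "\<alpha> ` I" v] by blast
    have "w (\<alpha> i) = w' (\<alpha> i)" if "i \<in> I" for i
      using fun_cong[OF eq, of "\<alpha> i"] simple_in_roots[OF that] by simp
    then have "w y = w' y"
      using linear_eq_on[of w w' y "\<alpha> ` I"] w yz(1) linear_weyl_group by blast
    moreover have "\<sigma> i z = z" if "i \<in> I" for i
      using yz(2)[OF simple_in_span[OF that]] by (simp add: simple_reflection pairing_alt orthogonal_def)
    then have "set xs \<subseteq> I \<Longrightarrow> word xs z = z" for xs by (induction xs) simp_all
    then have "w z = z" "w' z = z" using w weyl_group_word by blast+
    ultimately show "w v = w' v"
      using w linear_weyl_group linear_add yz(3) by metis
  qed
qed

text \<open>Applying the letters from the right, the image of \<open>\<alpha> i\<close> turns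
  negative at some letter \<open>a\<close>. Just before, it must be \<open>\<alpha> a\<close>, the
  only positive root that \<open>\<sigma> a\<close> makes negative. The letters applied so far then
  conjugate \<open>\<sigma> i\<close> into \<open>\<sigma> a\<close>, so multiplying by
  \<open>\<sigma> i\<close> on the right removes this letter.\<close>

lemma word_deletion:
  assumes "set xs \<subseteq> I" "i \<in> I" "\<not> pos (word xs (\<alpha> i))"
  shows "\<exists>ys. set ys \<subseteq> I \<and> length xs = Suc (length ys) \<and> word ys = word xs \<circ> \<sigma> i"
  using assms
proof (induction xs)
  case Nil
  then show ?case using pos_simple by simp
next
  case (Cons a xs)
  show ?case
  proof (cases "pos (word xs (\<alpha> i))")
    case False
    moreover have "set xs \<subseteq> I" using Cons.prems(1) by simp
    ultimately obtain ys where "set ys \<subseteq> I" "length xs = Suc (length ys)" "word ys = word xs \<circ> \<sigma> i"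
      using Cons.IH Cons.prems(2) by blast
    then show ?thesis using Cons.prems by (intro exI[of _ "a # ys"]) (simp add: comp_assoc)
  next
    case True
    then have eq: "word xs (\<alpha> i) = \<alpha> a"
      using Cons.prems pos_simple_reflection[OF True, of a] by auto
    have "\<sigma> a \<circ> word xs = word xs \<circ> \<sigma> i"
      using orthogonal_transformation_apply_reflection[OF orthogonal_transformation_word, of xs "\<alpha> i"] eq
      by (simp add: fun_eq_iff)
    then have "word (a # xs) \<circ> \<sigma> i = word xs" by (simp add: comp_assoc)
    then show ?thesis using Cons.prems(1) by (intro exI[of _ xs] conjI) (simp_all del: word.simps(2))
  qed
qed

text \<open>The induction step for both statements about orbits below. If no simple root becomes
  negative, the prefix without the last letter \<open>i\<close> sends \<open>\<alpha> i\<close> to a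
  negative root, and deletion there yields a shorter word for the same element.\<close>

lemma word_shorten:
  assumes "set xs \<subseteq> I" "xs \<noteq> []"
  obtains ys where "set ys \<subseteq> I" "length ys < length xs" "word ys = word xs"
    | ys i where "set ys \<subseteq> I" "length ys < length xs" "i \<in> I" "word ys = word xs \<circ> \<sigma> i"
        "pos (- word xs (\<alpha> i))"
proof (cases "\<forall>i\<in>I. pos (word xs (\<alpha> i))")
  case True
  obtain zs i where zs: "xs = zs @ [i]" using assms(2) by (metis rev_exhaust)
  then have i: "i \<in> I" "set zs \<subseteq> I" using assms(1) by auto
  have "word xs (\<alpha> i) = word zs (- \<alpha> i)"
    using simple_nonzero[OF i(1)] by (simp add: zs word_append reflection_self)
  also have "\<dots> = - word zs (\<alpha> i)"
    using orthogonal_transformation_word orthogonal_transformation_linear linear_neg by blast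
  finally have "\<not> pos (word zs (\<alpha> i))"
    using True i(1) not_pos_and_neg by force
  from word_deletion[OF i(2,1) this] obtain ys where
    "set ys \<subseteq> I" "length zs = Suc (length ys)" "word ys = word zs \<circ> \<sigma> i" by blast
  then show ?thesis by (intro that(1)[of ys]) (simp_all add: zs word_append)
next
  case False
  then obtain i where i: "i \<in> I" "\<not> pos (word xs (\<alpha> i))" by blast
  then have "pos (- word xs (\<alpha> i))"
    using pos_or_neg word_root[OF assms(1) simple_in_roots[OF i(1)]] by blast
  then show ?thesis using word_deletion[OF assms(1) i] i(1) that(2) by force
qed

text \<open>When \<open>\<alpha> i\<close> becomes negative, dominance of \<open>v\<close> and of
  its image bound \<open>v \<bullet> \<alpha> i\<close> from both sides by 0. So
  \<open>\<sigma> i\<close> fixes \<open>v\<close>, and the shorter word acts on \<open>v\<close> in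
  the same way.\<close>

lemma dominant_word_eq:
  assumes "set xs \<subseteq> I" "dominant v" "dominant (word xs v)"
  shows "word xs v = v"
  using assms(1,3)
proof (induction xs rule: length_induct)
  case (1 xs)
  show ?case
  proof (cases "xs = []")
    case False
    with 1(2) show ?thesis
    proof (cases rule: word_shorten)
      case (1 ys)
      then show ?thesis using "1.IH" "1.prems" by metis
    next
      case (2 ys i)
      have "0 \<le> v \<bullet> \<alpha> i" using assms(2) 2 by (auto simp: dominant_def)
      moreover have "word xs v \<bullet> word xs (\<alpha> i) \<le> 0"
        using inner_dominant_pos[OF 1(3) 2(5)] by simp
      ultimately have "v \<bullet> \<alpha> i = 0" by (simp add: inner_word)
      then have "\<sigma> i v = v" by (simp add: simple_reflection pairing_alt)
      then have "word ys v = word xs v" using 2(4) by simp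
      then show ?thesis using 2 1 by metis
    qed
  qed simp
qed

text \<open>For a word fixing \<open>v\<close>, a simple root cannot become negative: its product
  with \<open>v\<close> is positive and preserved. Only shortening to an equal element remains, down
  to the empty word.\<close>

lemma regular_dominant_stabilizer:
  assumes "set xs \<subseteq> I" "regular_dominant v" "word xs v = v"
  shows "word xs = id"
  using assms(1,3)
proof (induction xs rule: length_induct)
  case (1 xs)
  show ?case
  proof (cases "xs = []")
    case False
    with 1(2) show ?thesis
    proof (cases rule: word_shorten)
      case (1 ys)
      then show ?thesis using "1.IH" "1.prems" by metis
    next
      case (2 ys i)
      have "0 < v \<bullet> \<alpha> i" using assms(2) 2 by (auto simp: regular_dominant_def)
      moreover have "0 < v \<bullet> (- word xs (\<alpha> i))"
        by (rule inner_regular_dominant_pos[OF assms(2) 2(5)])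
      moreover have "v \<bullet> word xs (\<alpha> i) = v \<bullet> \<alpha> i"
        using inner_word[of xs v "\<alpha> i"] 1(3) by simp
      ultimately show ?thesis by simp
    qed
  qed simp
qed

lemma weyl_group_dominant_eq: "w \<in> W \<Longrightarrow> dominant v \<Longrightarrow> dominant (w v) \<Longrightarrow> w v = v"
  using weyl_group_word dominant_word_eq by blast

lemma weyl_group_regular_stabilizer: "w \<in> W \<Longrightarrow> regular_dominant v \<Longrightarrow> w v = v \<Longrightarrow> w = id"
  using weyl_group_word regular_dominant_stabilizer by blast

lemma regular_dominant_weyl_vector: "regular_dominant \<rho>"
  using inner_simple_weyl_vector by (simp add: regular_dominant_def inner_commute)

text \<open>At a maximum of the height no simple reflection can raise it, which is
  dominance.\<close>

lemma dominant_if_maximal: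
  assumes "w \<in> W" "\<And>u. u \<in> W \<Longrightarrow> u v \<bullet> \<rho> \<le> w v \<bullet> \<rho>"
  shows "dominant (w v)"
  unfolding dominant_def
  using assms(2)[OF weyl_group_comp[OF simple_reflection_in_weyl_group assms(1)]]
  by (simp add: inner_weyl_vector_simple_reflection)

lemma exists_maximal: "\<exists>w\<in>W. \<forall>u\<in>W. u v \<bullet> \<rho> \<le> w v \<bullet> \<rho>"
proof -
  have "W \<noteq> {}" using weyl_group.weyl_id by blast
  then have "Max ((\<lambda>u. u v \<bullet> \<rho>) ` W) \<in> (\<lambda>u. u v \<bullet> \<rho>) ` W"
    using finite_weyl_group by (intro Max_in) auto
  then obtain w where w: "w \<in> W" "Max ((\<lambda>u. u v \<bullet> \<rho>) ` W) = w v \<bullet> \<rho>" by blast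
  have "u v \<bullet> \<rho> \<le> w v \<bullet> \<rho>" if "u \<in> W" for u
    unfolding w(2)[symmetric] using that finite_weyl_group by (intro Max_ge) auto
  with w(1) show ?thesis by blast
qed

lemma exists_dominant: "\<exists>w\<in>W. dominant (w v)"
  using exists_maximal[of v] dominant_if_maximal by metis

text \<open>A maximal point of the orbit is dominant, and the orbit has only one dominant vector;
  hence the maximum is strict.\<close>

lemma inner_weyl_vector_less:
  assumes "dominant v" "w \<in> W" "w v \<noteq> v"
  shows "w v \<bullet> \<rho> < v \<bullet> \<rho>"
proof -
  obtain u where u: "u \<in> W" "\<And>u'. u' \<in> W \<Longrightarrow> u' v \<bullet> \<rho> \<le> u v \<bullet> \<rho>" using exists_maximal by blast
  then have "u v = v" using dominant_if_maximal weyl_group_dominant_eq assms(1) by blast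
  moreover have "w v \<bullet> \<rho> \<noteq> v \<bullet> \<rho>"
  proof
    assume "w v \<bullet> \<rho> = v \<bullet> \<rho>"
    then have "dominant (w v)" using u(2) \<open>u v = v\<close> assms(2) by (intro dominant_if_maximal) simp_all
    then show False using weyl_group_dominant_eq assms by blast
  qed
  ultimately show ?thesis using u(2)[OF assms(2)] by simp
qed

end

section \<open>Alternants and bialternants\<close>

lemma lookup_single_mult:
  fixes f :: "'a::ab_group_add \<Rightarrow>\<^sub>0 int"
  shows "Poly_Mapping.lookup (Poly_Mapping.single a c * f) k = c * Poly_Mapping.lookup f (k - a)"
proof -
  have eq: "(k = l + q) = (q = k - l)" for l q by (auto simp: algebra_simps)
  have "(\<Sum>q. Poly_Mapping.lookup f q when k = l + q) = Poly_Mapping.lookup f (k - l)" for l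
    by (simp add: eq)
  then show ?thesis
    by (simp add: lookup_mult lookup_single when_mult)
qed

text \<open>The integers have no 2-torsion. This covers alternants of vectors on a wall as well as
  sums that a permutation turns into their negative.\<close>

lemma eq_minus_imp_zero_poly_mapping:
  fixes f :: "'a \<Rightarrow>\<^sub>0 int"
  assumes "f = - f" shows "f = 0"
proof (rule poly_mapping_eqI)
  fix k
  have "Poly_Mapping.lookup f k = - Poly_Mapping.lookup f k"
    using assms by (metis lookup_uminus)
  then show "Poly_Mapping.lookup f k = Poly_Mapping.lookup 0 k" by simp
qed

context based_root_system
begin

section \<open>Signs and the antisymmetry of alternants\<close>

definition sign :: "(real^'n \<Rightarrow> real^'n) \<Rightarrow> int" where
  "sign w = \<lfloor>det (matrix w)\<rfloor>"

lemma alternant_eq: "alternant \<Phi> v = (\<Sum>w\<in>W. Poly_Mapping.single (w v) (sign w))"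
  by (simp add: alternant_def sign_def)

lemma sign_id: "sign id = 1"
  by (simp add: sign_def)

lemma sign_comp_simple_reflection:
  assumes "w \<in> W" "i \<in> I" shows "sign (w \<circ> \<sigma> i) = - sign w"
proof -
  have w: "orthogonal_transformation w" by (rule orthogonal_transformation_weyl_group[OF assms(1)])
  then have "det (matrix (w \<circ> \<sigma> i)) = - det (matrix w)"
    by (simp add: det_matrix_compose_orthogonal orthogonal_transformation_reflection
        det_reflection simple_nonzero assms(2))
  moreover have "det (matrix w) = 1 \<or> det (matrix w) = -1"
    using orthogonal_transformation_det[OF w] by linarith
  moreover have "\<lfloor>- 1 :: real\<rfloor> = - 1" by linarith
  ultimately show ?thesis by (auto simp: sign_def)
qed

text \<open>Right multiplication by \<open>\<sigma> i\<close> permutes the group and flips every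
  sign.\<close>

lemma alternant_simple_reflection:
  assumes "i \<in> I" shows "alternant \<Phi> (\<sigma> i v) = - alternant \<Phi> v"
proof -
  have "bij_betw (\<lambda>w. w \<circ> \<sigma> i) W W"
    using weyl_group_comp[OF _ simple_reflection_in_weyl_group[OF assms]]
    by (intro bij_betw_byWitness[where f' = "\<lambda>w. w \<circ> \<sigma> i"]) (auto simp: comp_assoc)
  then have "alternant \<Phi> (\<sigma> i v) = (\<Sum>w\<in>W. Poly_Mapping.single ((w \<circ> \<sigma> i) (\<sigma> i v)) (sign (w \<circ> \<sigma> i)))"
    unfolding alternant_eq
    by (rule sum.reindex_bij_betw[symmetric, where g = "\<lambda>w. Poly_Mapping.single (w (\<sigma> i v)) (sign w)"])
  also have "\<dots> = - alternant \<Phi> v"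
    by (simp add: alternant_eq sign_comp_simple_reflection assms single_uminus sum_negf)
  finally show ?thesis .
qed

lemma alternant_weyl_group:
  assumes "w \<in> W" shows "alternant \<Phi> (w v) = alternant \<Phi> v \<or> alternant \<Phi> (w v) = - alternant \<Phi> v"
proof -
  have "set xs \<subseteq> I \<Longrightarrow> alternant \<Phi> (word xs v) = alternant \<Phi> v \<or> alternant \<Phi> (word xs v) = - alternant \<Phi> v"
    for xs
    by (induction xs) (auto simp: alternant_simple_reflection)
  then show ?thesis using weyl_group_word[OF assms] by blast
qed

text \<open>On a wall, some simple reflection fixes \<open>v\<close> and yet negates its
  alternant.\<close>

lemma alternant_singular:
  assumes "dominant v" "\<not> regular_dominant v" shows "alternant \<Phi> v = 0"
proof -
  obtain i where i: "i \<in> I" "v \<bullet> \<alpha> i = 0"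
    using assms by (auto simp: dominant_def regular_dominant_def not_less intro: antisym)
  then have "\<sigma> i v = v" by (simp add: simple_reflection pairing_alt)
  then show ?thesis using alternant_simple_reflection[OF i(1), of v] eq_minus_imp_zero_poly_mapping by metis
qed

text \<open>In the summand of \<open>w\<close>, the index \<open>x\<close> may be replaced by
  \<open>\<phi> x\<close>, which turns \<open>w v + g x\<close> into \<open>w (v + g x)\<close>;
  exchanging the sums then collects alternants. Stating invariance by bijections of the index set
  takes care of multiplicities.\<close>

lemma alternant_mult_invariant:
  assumes inv: "\<And>w. w \<in> W \<Longrightarrow> \<exists>\<phi>. bij_betw \<phi> X X \<and> (\<forall>x\<in>X. g (\<phi> x) = w (g x))"
  shows "alternant \<Phi> v * (\<Sum>x\<in>X. Poly_Mapping.single (g x) 1) = (\<Sum>x\<in>X. alternant \<Phi> (v + g x))"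
proof -
  have *: "(\<Sum>x\<in>X. Poly_Mapping.single (w v + g x) (sign w)) = (\<Sum>x\<in>X. Poly_Mapping.single (w (v + g x)) (sign w))"
    if w: "w \<in> W" for w
  proof -
    obtain \<phi> where \<phi>: "bij_betw \<phi> X X" "\<And>x. x \<in> X \<Longrightarrow> g (\<phi> x) = w (g x)"
      using inv[OF w] by auto
    have "(\<Sum>x\<in>X. Poly_Mapping.single (w v + g x) (sign w)) = (\<Sum>x\<in>X. Poly_Mapping.single (w v + g (\<phi> x)) (sign w))"
      by (rule sum.reindex_bij_betw[OF \<phi>(1), symmetric])
    also have "\<dots> = (\<Sum>x\<in>X. Poly_Mapping.single (w (v + g x)) (sign w))"
      using linear_add[OF linear_weyl_group[OF w]] by (intro sum.cong) (simp_all add: \<phi>(2))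
    finally show ?thesis .
  qed
  have "alternant \<Phi> v * (\<Sum>x\<in>X. Poly_Mapping.single (g x) 1)
      = (\<Sum>w\<in>W. \<Sum>x\<in>X. Poly_Mapping.single (w v + g x) (sign w))"
    by (simp add: alternant_eq sum_product mult_single)
  also have "\<dots> = (\<Sum>w\<in>W. \<Sum>x\<in>X. Poly_Mapping.single (w (v + g x)) (sign w))"
    by (intro sum.cong refl *)
  also have "\<dots> = (\<Sum>x\<in>X. alternant \<Phi> (v + g x))"
    unfolding alternant_eq by (rule sum.swap)
  finally show ?thesis .
qed

text \<open>Among the exponents of the product, the one maximising the inner product with \<open>\<rho>\<close> only arises
  from the identity of the Weyl group.\<close>

lemma alternant_weyl_vector_nonzero_divisor:
  assumes "alternant \<Phi> \<rho> * f = 0" shows "f = 0"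
proof (rule ccontr)
  assume "f \<noteq> 0"
  then have "Poly_Mapping.keys f \<noteq> {}" by simp
  then have "Max ((\<lambda>\<mu>. \<mu> \<bullet> \<rho>) ` Poly_Mapping.keys f) \<in> (\<lambda>\<mu>. \<mu> \<bullet> \<rho>) ` Poly_Mapping.keys f"
    by (intro Max_in) auto
  then obtain \<kappa> where \<kappa>: "\<kappa> \<in> Poly_Mapping.keys f"
    "\<kappa> \<bullet> \<rho> = Max ((\<lambda>\<mu>. \<mu> \<bullet> \<rho>) ` Poly_Mapping.keys f)"
    by auto
  have max: "\<mu> \<bullet> \<rho> \<le> \<kappa> \<bullet> \<rho>" if "\<mu> \<in> Poly_Mapping.keys f" for \<mu>
    unfolding \<kappa>(2) using that by (intro Max_ge) auto
  have "sign w * Poly_Mapping.lookup f (\<rho> + \<kappa> - w \<rho>) = 0" if "w \<in> W - {id}" for w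
  proof -
    have "w \<rho> \<noteq> \<rho>"
      using weyl_group_regular_stabilizer[OF _ regular_dominant_weyl_vector] that by blast
    moreover have "dominant \<rho>"
      using regular_dominant_weyl_vector by (auto simp: regular_dominant_def dominant_def less_imp_le)
    ultimately have "w \<rho> \<bullet> \<rho> < \<rho> \<bullet> \<rho>" using inner_weyl_vector_less that by blast
    then have "\<kappa> \<bullet> \<rho> < (\<rho> + \<kappa> - w \<rho>) \<bullet> \<rho>" by (simp add: inner_diff_left inner_add_left)
    then have "\<rho> + \<kappa> - w \<rho> \<notin> Poly_Mapping.keys f" using max by (meson not_less)
    then show ?thesis by (simp add: in_keys_iff)
  qed
  then have "(\<Sum>w\<in>W. sign w * Poly_Mapping.lookup f (\<rho> + \<kappa> - w \<rho>))
      = (\<Sum>w\<in>{id}. sign w * Poly_Mapping.lookup f (\<rho> + \<kappa> - w \<rho>))"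
    using finite_weyl_group weyl_group.weyl_id by (intro sum.mono_neutral_right) auto
  moreover have "Poly_Mapping.lookup (alternant \<Phi> \<rho> * f) (\<rho> + \<kappa>)
      = (\<Sum>w\<in>W. sign w * Poly_Mapping.lookup f (\<rho> + \<kappa> - w \<rho>))"
    by (simp add: alternant_eq sum_distrib_right lookup_sum lookup_single_mult)
  ultimately have "Poly_Mapping.lookup f \<kappa> = 0" using assms by (simp add: sign_id)
  then show False using \<kappa>(1) by (simp add: in_keys_iff)
qed

lemma alternant_weyl_vector_cancel:
  "alternant \<Phi> \<rho> * f = alternant \<Phi> \<rho> * g \<Longrightarrow> f = g"
  using alternant_weyl_vector_nonzero_divisor[of "f - g"] by (simp add: right_diff_distrib)

text \<open>By Cauchy-Schwarz the integral pairings are bounded, and they determine the weight. This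
  is what makes induction on the length of a weight possible.\<close>

lemma finite_bounded_weights: "finite {v \<in> weight_lattice \<alpha> I. norm v \<le> r}" (is "finite ?A")
proof (rule finite_imageD)
  let ?h = "\<lambda>v. restrict (\<lambda>k. \<lfloor>pairing \<alpha> v k\<rfloor>) I"
  let ?B = "\<lambda>k. {- \<lceil>r * norm (coroot (\<alpha> k))\<rceil> .. \<lceil>r * norm (coroot (\<alpha> k))\<rceil>}"
  have "\<lfloor>pairing \<alpha> v k\<rfloor> \<in> ?B k" if "v \<in> ?A" for v k
  proof -
    have "\<bar>pairing \<alpha> v k\<bar> \<le> r * norm (coroot (\<alpha> k))"
      using that Cauchy_Schwarz_ineq2[of v "coroot (\<alpha> k)"] mult_right_mono[of "norm v" r "norm (coroot (\<alpha> k))"]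
      by (simp add: pairing_def)
    then show ?thesis
      unfolding atLeastAtMost_iff by linarith
  qed
  then have "?h ` ?A \<subseteq> PiE I ?B" by (auto simp: PiE_iff)
  then show "finite (?h ` ?A)" by (rule finite_subset) (simp add: finite_PiE finite_I)
  show "inj_on ?h ?A"
  proof (rule inj_onI)
    fix v w assume vw: "v \<in> ?A" "w \<in> ?A" and eq: "?h v = ?h w"
    have "pairing \<alpha> v k = pairing \<alpha> w k" if "k \<in> I" for k
      using fun_cong[OF eq, of k] vw that by (auto simp: weight_lattice_iff elim!: Ints_cases)
    then show "v = w" using vw by (intro span_eqI) (auto simp: weight_lattice_iff)
  qed
qed

lemma dominant_weight_dominant: "v \<in> dominant_weights \<alpha> I \<Longrightarrow> dominant v"
proof -
  assume v: "v \<in> dominant_weights \<alpha> I"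
  have "0 \<le> v \<bullet> \<alpha> k" if k: "k \<in> I" for k
  proof -
    have "0 < \<alpha> k \<bullet> \<alpha> k" "0 \<le> pairing \<alpha> v k"
      using v k simple_nonzero by (auto simp: dominant_weights_iff)
    then have "0 \<le> 2 * (v \<bullet> \<alpha> k)" unfolding pairing_alt by (simp only: zero_le_divide_iff) linarith
    then show ?thesis by simp
  qed
  then show "dominant v" by (simp add: dominant_def)
qed

text \<open>By integrality, positive pairings are at least 1, which is the value they have on
  \<open>\<rho>\<close>.\<close>

lemma regular_dominant_diff_weyl_vector:
  assumes "regular_dominant v" "v \<in> weight_lattice \<alpha> I"
  shows "v - \<rho> \<in> dominant_weights \<alpha> I"
proof -
  have "0 \<le> pairing \<alpha> (v - \<rho>) k" if k: "k \<in> I" for k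
  proof -
    have "0 < pairing \<alpha> v k" using assms(1) k simple_nonzero[OF k] by (simp add: regular_dominant_def pairing_alt)
    moreover have "pairing \<alpha> v k \<in> \<int>" using assms(2) k by (simp add: weight_lattice_iff)
    ultimately have "1 \<le> pairing \<alpha> v k" by (auto elim!: Ints_cases)
    then show ?thesis using k by (simp add: pairing_diff pairing_weyl_vector)
  qed
  then show ?thesis
    using assms(2) by (simp add: dominant_weights_iff weight_lattice_diff weyl_vector_lattice)
qed

text \<open>Both vectors of the orbit have the same norm, so the squared lengths differ by twice the
  difference of their products with \<open>\<rho>\<close>.\<close>

lemma norm_orbit_add_weyl_vector_less:
  assumes "dominant v" "w \<in> W" "w v \<noteq> v"
  shows "norm (\<rho> + w v) < norm (v + \<rho>)"
proof -
  have "(\<rho> + w v) \<bullet> (\<rho> + w v) < (v + \<rho>) \<bullet> (v + \<rho>)"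
    using inner_weyl_vector_less[OF assms] inner_weyl_group[OF assms(2), of v v]
    by (simp add: inner_add_left inner_add_right inner_commute)
  then show ?thesis by (simp add: norm_eq_sqrt_inner)
qed

text \<open>Multiplying the denominator with the orbit sum of \<open>\<mu>\<close> gives the alternant of \<open>\<mu> + \<rho>\<close>
  plus alternants of vectors that are strictly shorter than \<open>\<mu> + \<rho>\<close>, so that the quotients can
  be constructed by induction on this length.\<close>

lemma bialternant_exists:
  assumes "\<mu> \<in> dominant_weights \<alpha> I"
  shows "\<exists>f. Poly_Mapping.keys f \<subseteq> weight_lattice \<alpha> I \<and> alternant \<Phi> \<rho> * f = alternant \<Phi> (\<mu> + \<rho>)"
  using assms
\<comment> \<open>Lengths are real numbers; counting the dominant weights with a strictly smaller
  shifted length gives a measure in the natural numbers.\<close>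
proof (induction "card {\<nu> \<in> dominant_weights \<alpha> I. norm (\<nu> + \<rho>) < norm (\<mu> + \<rho>)}" arbitrary: \<mu> rule: less_induct)
  case less
  have fin: "finite {\<nu> \<in> dominant_weights \<alpha> I. norm (\<nu> + \<rho>) < r}" for r
  proof (rule finite_subset[OF _ finite_bounded_weights[of "r + norm \<rho>"]])
    have "norm \<nu> \<le> r + norm \<rho>" if "norm (\<nu> + \<rho>) < r" for \<nu>
      using norm_triangle_ineq4[of "\<nu> + \<rho>" \<rho>] that by simp
    then show "{\<nu> \<in> dominant_weights \<alpha> I. norm (\<nu> + \<rho>) < r} \<subseteq> {v \<in> weight_lattice \<alpha> I. norm v \<le> r + norm \<rho>}"
      by (auto simp: dominant_weights_iff)
  qed
  have dom: "dominant \<mu>" using less.prems by (rule dominant_weight_dominant)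
  have lat: "\<mu> \<in> weight_lattice \<alpha> I" using less.prems by (simp add: dominant_weights_iff)
  define Orb where "Orb = (\<lambda>w. w \<mu>) ` W"
  have finO: "finite Orb" by (simp add: Orb_def finite_weyl_group)
  have \<mu>Orb: "\<mu> \<in> Orb" unfolding Orb_def using weyl_group.weyl_id by (rule rev_image_eqI) simp
  have latO: "\<nu> \<in> weight_lattice \<alpha> I" if "\<nu> \<in> Orb" for \<nu>
    using that weyl_group_lattice lat by (auto simp: Orb_def)
  have "\<exists>f. Poly_Mapping.keys f \<subseteq> weight_lattice \<alpha> I \<and> alternant \<Phi> \<rho> * f = alternant \<Phi> (\<rho> + \<nu>)"
    if \<nu>: "\<nu> \<in> Orb - {\<mu>}" for \<nu>
  proof -
    \<comment> \<open>Moving into the dominant chamber changes the alternant at most by a sign.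
      There the vector either lies on a wall, with alternant 0, or has the form
      \<open>\<mu>' + \<rho>\<close> with \<open>\<mu>'\<close> dominant and covered by the
      induction hypothesis.\<close>
    obtain u where u: "u \<in> W" "dominant (u (\<rho> + \<nu>))" using exists_dominant by blast
    have sgn: "alternant \<Phi> (\<rho> + \<nu>) = alternant \<Phi> (u (\<rho> + \<nu>)) \<or> alternant \<Phi> (\<rho> + \<nu>) = - alternant \<Phi> (u (\<rho> + \<nu>))"
      using alternant_weyl_group[OF u(1), of "\<rho> + \<nu>"] by force
    show ?thesis
    proof (cases "regular_dominant (u (\<rho> + \<nu>))")
      case False
      then have "alternant \<Phi> (\<rho> + \<nu>) = 0" using alternant_singular[OF u(2)] sgn by auto
      then show ?thesis by (intro exI[of _ 0]) simp
    next
      case True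
      define \<mu>' where "\<mu>' = u (\<rho> + \<nu>) - \<rho>"
      have "\<mu>' \<in> dominant_weights \<alpha> I"
        unfolding \<mu>'_def using True \<nu>
        by (intro regular_dominant_diff_weyl_vector weyl_group_lattice[OF u(1)] weight_lattice_add
            weyl_vector_lattice latO) auto
      moreover have lt: "norm (\<mu>' + \<rho>) < norm (\<mu> + \<rho>)"
        using \<nu> norm_orbit_add_weyl_vector_less[OF dom]
          orthogonal_transformation_norm[OF orthogonal_transformation_weyl_group[OF u(1)]]
        by (auto simp: \<mu>'_def Orb_def)
      moreover have "card {\<nu> \<in> dominant_weights \<alpha> I. norm (\<nu> + \<rho>) < norm (\<mu>' + \<rho>)}
          < card {\<nu> \<in> dominant_weights \<alpha> I. norm (\<nu> + \<rho>) < norm (\<mu> + \<rho>)}"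
        using fin calculation by (intro psubset_card_mono) auto
      ultimately obtain f where
        "Poly_Mapping.keys f \<subseteq> weight_lattice \<alpha> I" "alternant \<Phi> \<rho> * f = alternant \<Phi> (\<mu>' + \<rho>)"
        using less.hyps[of \<mu>'] by blast
      then show ?thesis
        using sgn by (intro exI[of _ "if alternant \<Phi> (\<rho> + \<nu>) = alternant \<Phi> (u (\<rho> + \<nu>)) then f else - f"])
          (auto simp: \<mu>'_def)
    qed
  qed
  then obtain f where f: "\<And>\<nu>. \<nu> \<in> Orb - {\<mu>} \<Longrightarrow> Poly_Mapping.keys (f \<nu>) \<subseteq> weight_lattice \<alpha> I"
    "\<And>\<nu>. \<nu> \<in> Orb - {\<mu>} \<Longrightarrow> alternant \<Phi> \<rho> * f \<nu> = alternant \<Phi> (\<rho> + \<nu>)"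
    by metis
  have inv: "\<exists>\<phi>. bij_betw \<phi> Orb Orb \<and> (\<forall>\<nu>\<in>Orb. id (\<phi> \<nu>) = w (id \<nu>))" if w: "w \<in> W" for w
  proof -
    obtain w' where w': "w' \<in> W" "w' \<circ> w = id" "w \<circ> w' = id" by (rule weyl_group_inverse[OF w])
    have img: "u ` Orb \<subseteq> Orb" if "u \<in> W" for u
    proof -
      have "u (v \<mu>) \<in> Orb" if "v \<in> W" for v
        unfolding Orb_def using weyl_group_comp[OF \<open>u \<in> W\<close> that] by (rule rev_image_eqI) simp
      then show ?thesis by (auto simp: Orb_def)
    qed
    have "bij_betw w Orb Orb"
    proof (rule bij_betw_byWitness[where f' = w'])
      show "\<forall>\<nu>\<in>Orb. w' (w \<nu>) = \<nu>" using w'(2) by (simp add: fun_eq_iff)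
      show "\<forall>\<nu>\<in>Orb. w (w' \<nu>) = \<nu>" using w'(3) by (simp add: fun_eq_iff)
    qed (rule img[OF w], rule img[OF w'(1)])
    then show ?thesis by auto
  qed
  have keys_sum: "Poly_Mapping.keys (sum h A) \<subseteq> weight_lattice \<alpha> I"
    if "\<And>\<nu>. \<nu> \<in> A \<Longrightarrow> Poly_Mapping.keys (h \<nu>) \<subseteq> weight_lattice \<alpha> I" for h :: "real^'n \<Rightarrow> real^'n \<Rightarrow>\<^sub>0 int" and A
    using that
  proof (induction A rule: infinite_finite_induct)
    case (insert x A)
    then show ?case using keys_add[of "h x" "sum h A"] by auto
  qed simp_all
  have "alternant \<Phi> \<rho> * (\<Sum>\<nu>\<in>Orb. Poly_Mapping.single \<nu> 1) = (\<Sum>\<nu>\<in>Orb. alternant \<Phi> (\<rho> + \<nu>))"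
    using alternant_mult_invariant[OF inv] by simp
  also have "\<dots> = alternant \<Phi> (\<rho> + \<mu>) + (\<Sum>\<nu>\<in>Orb - {\<mu>}. alternant \<Phi> (\<rho> + \<nu>))"
    by (rule sum.remove[OF finO \<mu>Orb])
  finally have "alternant \<Phi> \<rho> * ((\<Sum>\<nu>\<in>Orb. Poly_Mapping.single \<nu> 1) - (\<Sum>\<nu>\<in>Orb - {\<mu>}. f \<nu>)) = alternant \<Phi> (\<mu> + \<rho>)"
    by (simp add: right_diff_distrib sum_distrib_left f(2) add.commute)
  moreover have "Poly_Mapping.keys ((\<Sum>\<nu>\<in>Orb. Poly_Mapping.single \<nu> 1) - (\<Sum>\<nu>\<in>Orb - {\<mu>}. f \<nu>) :: real^'n \<Rightarrow>\<^sub>0 int) \<subseteq> weight_lattice \<alpha> I"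
  proof (rule order_trans[OF keys_diff], rule Un_least)
    show "Poly_Mapping.keys (\<Sum>\<nu>\<in>Orb. Poly_Mapping.single \<nu> 1 :: real^'n \<Rightarrow>\<^sub>0 int) \<subseteq> weight_lattice \<alpha> I"
      by (rule keys_sum) (simp add: latO)
    show "Poly_Mapping.keys (\<Sum>\<nu>\<in>Orb - {\<mu>}. f \<nu>) \<subseteq> weight_lattice \<alpha> I"
      by (rule keys_sum) (rule f(1))
  qed
  ultimately show ?case by (intro exI conjI)
qed

text \<open>Justifies the definite description: the quotient exists by
  \<open>bialternant_exists\<close> and is unique because \<open>alternant \<Phi> \<rho>\<close> can
  be cancelled.\<close>

lemma alternant_mult_bialternant:
  assumes "\<mu> \<in> dominant_weights \<alpha> I"
  shows "alternant \<Phi> \<rho> * bialternant \<Phi> \<alpha> I \<mu> = alternant \<Phi> (\<mu> + \<rho>)"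
proof -
  have "Poly_Mapping.keys (bialternant \<Phi> \<alpha> I \<mu>) \<subseteq> weight_lattice \<alpha> I \<and>
      alternant \<Phi> \<rho> * bialternant \<Phi> \<alpha> I \<mu> = alternant \<Phi> (\<mu> + \<rho>)"
    unfolding bialternant_def
  proof (rule theI', rule ex_ex1I)
    show "f = g" if "Poly_Mapping.keys f \<subseteq> weight_lattice \<alpha> I \<and> alternant \<Phi> \<rho> * f = alternant \<Phi> (\<mu> + \<rho>)"
      "Poly_Mapping.keys g \<subseteq> weight_lattice \<alpha> I \<and> alternant \<Phi> \<rho> * g = alternant \<Phi> (\<mu> + \<rho>)" for f g
      by (rule alternant_weyl_vector_cancel) (use that in simp)
  qed (rule bialternant_exists[OF assms])
  then show ?thesis by blast
qed

lemma bijection_from_simple_reflections: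
  assumes simple: "\<And>i. i \<in> I \<Longrightarrow> \<exists>\<phi>. bij_betw \<phi> X X \<and> (\<forall>x\<in>X. g (\<phi> x) = \<sigma> i (g x))"
    and "w \<in> W"
  shows "\<exists>\<phi>. bij_betw \<phi> X X \<and> (\<forall>x\<in>X. g (\<phi> x) = w (g x))"
proof -
  have "set xs \<subseteq> I \<Longrightarrow> \<exists>\<phi>. bij_betw \<phi> X X \<and> (\<forall>x\<in>X. g (\<phi> x) = word xs (g x))" for xs
  proof (induction xs)
    case Nil
    show ?case by (intro exI[of _ id] conjI bij_betw_id) simp
  next
    case (Cons i xs)
    then obtain \<phi> \<psi> where "bij_betw \<phi> X X" "\<forall>x\<in>X. g (\<phi> x) = word xs (g x)"
      "bij_betw \<psi> X X" "\<forall>x\<in>X. g (\<psi> x) = \<sigma> i (g x)"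
      using simple[of i] by auto
    then show ?case
      by (intro exI[of _ "\<psi> \<circ> \<phi>"] conjI bij_betw_trans[of \<phi> X X \<psi>]) (auto dest: bij_betwE)
  qed
  then show ?thesis using weyl_group_word[OF assms(2)] by blast
qed

text \<open>Separates the algebra from the combinatorics: the poset enters only through bijections
  that reflect the weights and through the cancelling permutation \<open>\<psi>\<close>. The sum
  over \<open>X - M\<close> equals its own negative, so elements fixed by \<open>\<psi>\<close> are
  handled together with the pairs.\<close>

lemma bialternant_mult_invariant:
  assumes "\<mu> \<in> dominant_weights \<alpha> I" and "finite X"
    and simple: "\<And>i. i \<in> I \<Longrightarrow> \<exists>\<phi>. bij_betw \<phi> X X \<and> (\<forall>x\<in>X. g (\<phi> x) = \<sigma> i (g x))"
    and M: "M \<subseteq> X" "\<And>m. m \<in> M \<Longrightarrow> \<mu> + g m \<in> dominant_weights \<alpha> I"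
    and \<psi>: "bij_betw \<psi> (X - M) (X - M)"
      "\<And>x. x \<in> X - M \<Longrightarrow> \<exists>i\<in>I. \<mu> + g (\<psi> x) + \<rho> = \<sigma> i (\<mu> + g x + \<rho>)"
  shows "bialternant \<Phi> \<alpha> I \<mu> * (\<Sum>x\<in>X. Poly_Mapping.single (g x) 1)
      = (\<Sum>m\<in>M. bialternant \<Phi> \<alpha> I (\<mu> + g m))"
proof (rule alternant_weyl_vector_cancel)
  let ?A = "\<lambda>x. alternant \<Phi> (\<mu> + g x + \<rho>)"
  have "sum ?A (X - M) = (\<Sum>x\<in>X - M. ?A (\<psi> x))"
    by (rule sum.reindex_bij_betw[OF \<psi>(1), symmetric])
  also have "\<dots> = (\<Sum>x\<in>X - M. - ?A x)"
  proof (rule sum.cong)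
    fix x assume "x \<in> X - M"
    then obtain i where "i \<in> I" "\<mu> + g (\<psi> x) + \<rho> = \<sigma> i (\<mu> + g x + \<rho>)" using \<psi>(2) by blast
    then show "?A (\<psi> x) = - ?A x" by (simp only: alternant_simple_reflection)
  qed simp
  finally have "sum ?A (X - M) = - sum ?A (X - M)" by (simp only: sum_negf)
  then have "sum ?A (X - M) = 0" by (rule eq_minus_imp_zero_poly_mapping)
  then have "sum ?A X = sum ?A M" using sum.subset_diff[OF M(1) assms(2), of ?A] by simp
  moreover have "alternant \<Phi> \<rho> * (bialternant \<Phi> \<alpha> I \<mu> * (\<Sum>x\<in>X. Poly_Mapping.single (g x) 1)) = sum ?A X"
    using alternant_mult_invariant[OF bijection_from_simple_reflections[OF simple], of "\<mu> + \<rho>"]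
    by (simp add: mult.assoc[symmetric] alternant_mult_bialternant[OF assms(1)] add_ac)
  moreover have "alternant \<Phi> \<rho> * (\<Sum>m\<in>M. bialternant \<Phi> \<alpha> I (\<mu> + g m)) = sum ?A M"
    using M(2) by (simp add: sum_distrib_left alternant_mult_bialternant)
  ultimately show "alternant \<Phi> \<rho> * (bialternant \<Phi> \<alpha> I \<mu> * (\<Sum>x\<in>X. Poly_Mapping.single (g x) 1))
      = alternant \<Phi> \<rho> * (\<Sum>m\<in>M. bialternant \<Phi> \<alpha> I (\<mu> + g m))" by simp
qed

end

section \<open>The strings of an admissible system\<close>

text \<open>The rank has to start at 0 without gaps, although \<open>D\<close> may be disconnected;
  so \<open>h\<close> is shifted on each component by its minimum there. Walking from a minimal
  element to \<open>x\<close> changes the rank by one per step, hence meets every smaller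
  value.\<close>

lemma ranked_if_graded:
  fixes h :: "'x \<Rightarrow> real"
  assumes "finite X" "D \<subseteq> X \<times> X" and step: "\<And>s t. (s, t) \<in> D \<Longrightarrow> h t = h s + 1"
  shows "ranked X D"
proof (cases "X = {}")
  case False
  define C where "C x = {y. (x, y) \<in> (D \<union> D\<inverse>)\<^sup>*}" for x
  define r where "r x = nat \<lfloor>h x - Min (h ` C x)\<rfloor>" for x
  have CX: "C x \<subseteq> X" if "x \<in> X" for x
  proof -
    have "(x, y) \<in> (D \<union> D\<inverse>)\<^sup>* \<Longrightarrow> y \<in> X" for y
      by (induction rule: rtrancl_induct) (use that assms(2) in auto)
    then show ?thesis by (auto simp: C_def)
  qed
  have finC: "finite (h ` C x)" and self: "x \<in> C x" if "x \<in> X" for x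
    using finite_subset[OF CX[OF that] assms(1)] by (auto simp: C_def)
  have sym: "sym ((D \<union> D\<inverse>)\<^sup>*)" by (intro sym_rtrancl) (auto simp: sym_def)
  have C_eq: "C x = C y" if "y \<in> C x" for x y
    using that symD[OF sym] unfolding C_def by (auto intro: rtrancl_trans)
  have r_step: "r t = r s + 1" if st: "(s, t) \<in> D" for s t
  proof -
    have sX: "s \<in> X" using st assms(2) by auto
    have "C t = C s" using st C_eq[of t s] by (auto simp: C_def)
    moreover have "Min (h ` C s) \<le> h s" using finC[OF sX] self[OF sX] by (intro Min_le) auto
    then have "0 \<le> \<lfloor>h s - Min (h ` C s)\<rfloor>"
      "\<lfloor>h t - Min (h ` C s)\<rfloor> = \<lfloor>h s - Min (h ` C s)\<rfloor> + 1"
      using step[OF st] by linarith+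
    ultimately show ?thesis by (simp add: r_def nat_add_distrib)
  qed
  have down: "\<exists>z\<in>X. r z = n" if x: "x \<in> X" and n: "n \<le> r x" for x n
  proof -
    have "Min (h ` C x) \<in> h ` C x" using finC[OF x] self[OF x] by (intro Min_in) auto
    then obtain x0 where x0: "x0 \<in> C x" "h x0 = Min (h ` C x)" by auto
    then have "r x0 = 0" using C_eq[OF x0(1)] by (simp add: r_def)
    have "x \<in> C x0" using C_eq[OF x0(1)] self[OF x] by simp
    then have "(x0, x) \<in> (D \<union> D\<inverse>)\<^sup>*" by (simp add: C_def)
    then show ?thesis using n
    proof (induction rule: rtrancl_induct)
      case base
      then show ?case using \<open>r x0 = 0\<close> x0(1) CX[OF x] by auto
    next
      case (step y z)
      have "z \<in> X" "r z = r y + 1 \<or> r y = r z + 1" using step(2) assms(2) r_step by auto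
      then show ?case using step by (cases "n = r z") auto
    qed
  qed
  have "r ` X = {0..Max (r ` X)}"
  proof (intro antisym subsetI)
    have "Max (r ` X) \<in> r ` X" using False assms(1) by (intro Max_in) auto
    then show "n \<in> r ` X" if "n \<in> {0..Max (r ` X)}" for n using down that by fastforce
  qed (use assms(1) in auto)
  then have "rank_function X D r (Max (r ` X))" using r_step by (simp add: rank_function_def)
  then show ?thesis unfolding ranked_def by blast
qed (simp add: ranked_def)

text \<open>\<open>restrict_elt\<close> runs over distinct exponents, which may merge several
  elements of \<open>X\<close>. Writing each coefficient as a count of preimages separates them
  again.\<close>

lemma restrict_elt_sum_single:
  assumes "finite X"
  shows "restrict_elt \<alpha> J (\<Sum>x\<in>X. Poly_Mapping.single (h x) 1)
      = (\<Sum>x\<in>X. Poly_Mapping.single (restrict_weight \<alpha> J (h x)) 1)"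
proof -
  let ?f = "\<Sum>x\<in>X. Poly_Mapping.single (h x) (1::int)"
  let ?r = "restrict_weight \<alpha> J"
  have lk: "Poly_Mapping.lookup ?f v = (\<Sum>x\<in>X. if h x = v then 1 else 0)" for v
    by (simp add: lookup_sum lookup_single when_def eq_commute)
  have "Poly_Mapping.keys ?f \<subseteq> h ` X"
    by (rule subsetI, rule ccontr) (auto simp: in_keys_iff lk intro!: sum.neutral)
  then have "restrict_elt \<alpha> J ?f = (\<Sum>v\<in>h ` X. Poly_Mapping.single (?r v) (Poly_Mapping.lookup ?f v))"
    unfolding restrict_elt_def using assms
    by (intro sum.mono_neutral_left) (auto simp: in_keys_iff)
  also have "\<dots> = (\<Sum>v\<in>h ` X. \<Sum>x\<in>X. if h x = v then Poly_Mapping.single (?r v) 1 else 0)"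
  proof (rule sum.cong[OF refl])
    fix v
    have "Poly_Mapping.single (?r v) (\<Sum>x\<in>A. if h x = v then 1 else 0 :: int)
        = (\<Sum>x\<in>A. if h x = v then Poly_Mapping.single (?r v) 1 else 0)" for A
      by (induction A rule: infinite_finite_induct) (auto simp: single_add)
    then show "Poly_Mapping.single (?r v) (Poly_Mapping.lookup ?f v)
        = (\<Sum>x\<in>X. if h x = v then Poly_Mapping.single (?r v) 1 else 0)" by (simp only: lk)
  qed
  also have "\<dots> = (\<Sum>x\<in>X. \<Sum>v\<in>h ` X. if h x = v then Poly_Mapping.single (?r v) 1 else 0)"
    by (rule sum.swap)
  also have "\<dots> = (\<Sum>x\<in>X. Poly_Mapping.single (?r (h x)) 1)"
    using assms by (intro sum.cong refl) simp
  finally show ?thesis .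
qed

lemma least_wrt_eq_iff:
  assumes "linear_order_on A r" "S \<subseteq> A" "finite S" "S \<noteq> {}"
  shows "least_wrt r S = i \<longleftrightarrow> i \<in> S \<and> (\<forall>j\<in>S. (i, j) \<in> r)"
proof -
  have lin: "refl_on A r" "trans r" "antisym r" "total_on A r"
    using assms(1) by (auto simp: order_on_defs)
  have unique: "i = i'" if "i \<in> S \<and> (\<forall>j\<in>S. (i, j) \<in> r)" "i' \<in> S \<and> (\<forall>j\<in>S. (i', j) \<in> r)" for i i'
    using that antisymD[OF lin(3)] by blast
  have "\<exists>i\<in>S. \<forall>j\<in>S. (i, j) \<in> r"
    using assms(3,4,2)
  proof (induction rule: finite_ne_induct)
    case (singleton x)
    then show ?case using lin(1) by (auto simp: refl_on_def)
  next
    case (insert x S)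
    then obtain i where i: "i \<in> S" "\<forall>j\<in>S. (i, j) \<in> r" by auto
    have "(x, i) \<in> r \<or> (i, x) \<in> r" "(x, x) \<in> r"
      using lin(1,4) insert.prems i(1) insert.hyps by (auto simp: refl_on_def total_on_def)
    then show ?case
    proof (elim conjE disjE)
      assume "(x, i) \<in> r"
      then have "\<forall>j\<in>S. (x, j) \<in> r" using i(2) transD[OF lin(2)] by blast
      then show ?thesis using \<open>(x, x) \<in> r\<close> by blast
    qed (use i in blast)
  qed
  then have ex1: "\<exists>!i. i \<in> S \<and> (\<forall>j\<in>S. (i, j) \<in> r)" using unique by blast
  then show ?thesis
    unfolding least_wrt_def using theI'[OF ex1] unique by blast
qed

locale admissible = based_root_system \<Phi> I \<alpha>
  for \<Phi> :: "(real^'n) set" and I :: "'i set" and \<alpha> :: "'i \<Rightarrow> real^'n" +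
  fixes X :: "'x set" and \<mu> dbar :: "'x \<Rightarrow> real^'n" and F :: "'i \<Rightarrow> 'x \<rightharpoonup> 'x"
  assumes adm: "admissible_system \<alpha> I X \<mu> dbar F"
begin

abbreviation E :: "'i \<Rightarrow> 'x rel" where "E \<equiv> G_graph F"

text \<open>\<open>dep\<close> and \<open>eps\<close> are natural-number forms of the coefficients
  bounded in (A1). They turn out to be depth and rank in the string (\<open>depth_eq\<close>,
  \<open>comp_rank\<close>).\<close>

definition dep :: "'i \<Rightarrow> 'x \<Rightarrow> nat" where "dep i x = nat \<lfloor>- pairing \<alpha> (dbar x) i\<rfloor>"
definition eps :: "'i \<Rightarrow> 'x \<Rightarrow> nat" where "eps i x = nat \<lfloor>pairing \<alpha> (\<mu> x - dbar x) i\<rfloor>"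

lemma finite_X: "finite X"
  and lattice: "x \<in> X \<Longrightarrow> \<mu> x \<in> weight_lattice \<alpha> I"
  and dominance: "x \<in> X \<Longrightarrow> - dbar x \<in> dominant_weights \<alpha> I" "x \<in> X \<Longrightarrow> \<mu> x - dbar x \<in> dominant_weights \<alpha> I"
  and dom_F: "i \<in> I \<Longrightarrow> dom (F i) = {x\<in>X. pairing \<alpha> (\<mu> x - dbar x) i > 0}"
  and ran_F: "i \<in> I \<Longrightarrow> ran (F i) = {x\<in>X. pairing \<alpha> (dbar x) i < 0}"
  and inj_F: "i \<in> I \<Longrightarrow> inj_on (F i) (dom (F i))"
  and F_step: "i \<in> I \<Longrightarrow> x \<in> X \<Longrightarrow> F i x = Some x' \<Longrightarrow> \<mu> x' = \<mu> x - \<alpha> i"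
    "i \<in> I \<Longrightarrow> x \<in> X \<Longrightarrow> F i x = Some x' \<Longrightarrow> pairing \<alpha> (dbar x') i = pairing \<alpha> (dbar x) i - 1"
  and timing_exists: "\<exists>t. coherent_timing_pattern \<alpha> I X dbar F t"
  using adm unfolding admissible_system_def by auto

lemma real_dep: "x \<in> X \<Longrightarrow> i \<in> I \<Longrightarrow> real (dep i x) = - pairing \<alpha> (dbar x) i"
  and real_eps: "x \<in> X \<Longrightarrow> i \<in> I \<Longrightarrow> real (eps i x) = pairing \<alpha> (\<mu> x - dbar x) i"
proof -
  have aux: "real (nat \<lfloor>pairing \<alpha> v i\<rfloor>) = pairing \<alpha> v i" if "v \<in> dominant_weights \<alpha> I" "i \<in> I" for v i
    using that by (auto simp: dominant_weights_iff weight_lattice_iff)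
  show "x \<in> X \<Longrightarrow> i \<in> I \<Longrightarrow> real (dep i x) = - pairing \<alpha> (dbar x) i"
    using aux[OF dominance(1)] by (simp add: dep_def pairing_minus)
  show "x \<in> X \<Longrightarrow> i \<in> I \<Longrightarrow> real (eps i x) = pairing \<alpha> (\<mu> x - dbar x) i"
    using aux[OF dominance(2)] by (simp add: eps_def)
qed

lemma pairing_mu: "x \<in> X \<Longrightarrow> i \<in> I \<Longrightarrow> pairing \<alpha> (\<mu> x) i = real (eps i x) - real (dep i x)"
  by (simp add: real_dep real_eps pairing_diff)

lemma edge_iff: "(y, x) \<in> E i \<longleftrightarrow> F i x = Some y"
  by (simp add: G_graph_def)

lemma edge:
  assumes "i \<in> I" "(y, x) \<in> E i"
  shows "x \<in> X" "y \<in> X" "dep i y = Suc (dep i x)" "eps i x = Suc (eps i y)" "\<mu> x = \<mu> y + \<alpha> i"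
proof -
  have F: "F i x = Some y" using assms by (simp add: edge_iff)
  then show xX: "x \<in> X" using dom_F[OF assms(1)] by auto
  show yX: "y \<in> X" using ran_F[OF assms(1)] F by (auto simp: ran_def)
  note st = F_step[OF assms(1) xX F]
  show "\<mu> x = \<mu> y + \<alpha> i" using st by simp
  have "real (dep i y) = real (Suc (dep i x))"
    using st(2) by (simp add: real_dep[OF xX assms(1)] real_dep[OF yX assms(1)])
  then show "dep i y = Suc (dep i x)" by (simp only: of_nat_eq_iff)
  have "real (eps i x) = real (Suc (eps i y))"
    using st pairing_self[OF assms(1)]
    by (simp add: real_eps[OF xX assms(1)] real_eps[OF yX assms(1)] pairing_diff)
  then show "eps i x = Suc (eps i y)" by (simp only: of_nat_eq_iff)
qed

lemma edge_down: assumes "i \<in> I" "x \<in> X" "0 < eps i x" shows "\<exists>y. (y, x) \<in> E i"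
proof -
  have "0 < real (eps i x)" using assms by simp
  then have "x \<in> dom (F i)" using assms by (simp add: dom_F real_eps)
  then show ?thesis by (auto simp: edge_iff)
qed

lemma edge_up: assumes "i \<in> I" "x \<in> X" "0 < dep i x" shows "\<exists>y. (x, y) \<in> E i"
proof -
  have "0 < real (dep i x)" using assms by simp
  then have "x \<in> ran (F i)" using assms by (simp add: ran_F real_dep)
  then show ?thesis by (auto simp: edge_iff ran_def)
qed

lemma single_valued_edges:
  assumes "i \<in> I" shows "single_valued (E i)" "single_valued ((E i)\<inverse>)"
  using inj_F[OF assms] unfolding single_valued_def converse_iff edge_iff inj_on_def dom_def by auto

lemma path:
  assumes "(y, x) \<in> (E i)\<^sup>*" "i \<in> I"
  shows "dep i x \<le> dep i y" "dep i x = dep i y \<Longrightarrow> x = y" "x \<in> X \<longleftrightarrow> y \<in> X"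
  using assms(1)
proof (induction rule: rtrancl_induct)
  case (step u v)
  note e = edge[OF assms(2) step(2)]
  { case 1 show ?case using e step by simp }
  { case 2 then show ?case using e step by simp }
  { case 3 show ?case using e step by simp }
qed simp_all

lemma color_comp_sym: "y \<in> color_comp E i x \<Longrightarrow> x \<in> color_comp E i y"
  unfolding color_comp_def mem_Collect_eq
  by (rule symD[OF sym_rtrancl]) (auto simp: sym_def)

lemma color_comp_trans: "y \<in> color_comp E i x \<Longrightarrow> z \<in> color_comp E i y \<Longrightarrow> z \<in> color_comp E i x"
  unfolding color_comp_def mem_Collect_eq by (rule rtrancl_trans)

lemma color_comp_eq: "y \<in> color_comp E i x \<Longrightarrow> color_comp E i y = color_comp E i x"
  using color_comp_sym color_comp_trans by blast

lemma color_comp_self: "x \<in> color_comp E i x"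
  by (simp add: color_comp_def)

lemma path_color_comp: "(x, y) \<in> (E i)\<^sup>* \<Longrightarrow> y \<in> color_comp E i x"
  unfolding color_comp_def mem_Collect_eq by (rule rtrancl_mono[THEN subsetD]) auto

text \<open>Since \<open>F i\<close> is a partial injection, a string branches neither upwards nor
  downwards, so each further step of a zigzag stays comparable with its start.\<close>

lemma color_comp_chain:
  assumes "i \<in> I" "y \<in> color_comp E i x"
  shows "(x, y) \<in> (E i)\<^sup>* \<or> (y, x) \<in> (E i)\<^sup>*"
proof -
  have "(x, y) \<in> (E i \<union> (E i)\<inverse>)\<^sup>*" using assms(2) by (simp add: color_comp_def)
  then show ?thesis
  proof (induction rule: rtrancl_induct)
    case (step y z)
    from step(3) show ?case
    proof
      assume xy: "(x, y) \<in> (E i)\<^sup>*"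
      show ?case
      proof (cases "(y, z) \<in> E i")
        case False
        then have "(y, x) \<in> ((E i)\<inverse>)\<^sup>*" "(y, z) \<in> ((E i)\<inverse>)\<^sup>*"
          using step(2) xy by (auto simp: rtrancl_converse)
        then have "(x, z) \<in> ((E i)\<inverse>)\<^sup>* \<or> (z, x) \<in> ((E i)\<inverse>)\<^sup>*"
          using single_valued_confluent[OF single_valued_edges(2)[OF assms(1)]] by blast
        then show ?thesis by (auto simp: rtrancl_converse)
      qed (use xy in auto)
    next
      assume yx: "(y, x) \<in> (E i)\<^sup>*"
      show ?case
      proof (cases "(y, z) \<in> E i")
        case True
        then have "(y, z) \<in> (E i)\<^sup>*" by auto
        then show ?thesis
          using single_valued_confluent[OF single_valued_edges(1)[OF assms(1)] yx] by blast
      next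
        case False
        then show ?thesis using step(2) yx by (auto intro: converse_rtrancl_into_rtrancl)
      qed
    qed
  qed simp
qed

text \<open>The conserved quantities of a string: its length, and the weight that belongs to depth
  0.\<close>

lemma color_comp:
  assumes "i \<in> I" "x \<in> X" "y \<in> color_comp E i x"
  shows "y \<in> X" "eps i y + dep i y = eps i x + dep i x"
    "\<mu> y + real (dep i y) *\<^sub>R \<alpha> i = \<mu> x + real (dep i x) *\<^sub>R \<alpha> i"
  using assms(3) unfolding color_comp_def mem_Collect_eq
proof (induction rule: rtrancl_induct)
  case base
  { case 1 show ?case using assms by simp }
  { case 2 show ?case by simp }
  { case 3 show ?case by simp }
next
  case (step u v)
  have "v \<in> X \<and> eps i v + dep i v = eps i u + dep i u \<and>
      \<mu> v + real (dep i v) *\<^sub>R \<alpha> i = \<mu> u + real (dep i u) *\<^sub>R \<alpha> i"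
    using step(2)
  proof
    assume "(u, v) \<in> E i"
    from edge[OF assms(1) this] show ?thesis by (simp add: algebra_simps)
  next
    assume "(u, v) \<in> (E i)\<inverse>"
    then have "(v, u) \<in> E i" by simp
    from edge[OF assms(1) this] show ?thesis by (simp add: algebra_simps)
  qed
  note * = this
  { case 1 show ?case using * by simp }
  { case 2 show ?case using * step(4) by simp }
  { case 3 show ?case using * step(5) by simp }
qed

lemma color_comp_inj:
  assumes "i \<in> I" "y \<in> color_comp E i x" "z \<in> color_comp E i x" "dep i y = dep i z"
  shows "y = z"
  using color_comp_chain[OF assms(1), of z y] color_comp_eq[OF assms(2)] assms(3) path(2)[OF _ assms(1)] assms(4)
  by metis

lemma color_comp_path_iff:
  assumes "i \<in> I" "y \<in> color_comp E i x" "z \<in> color_comp E i x"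
  shows "(y, z) \<in> (E i)\<^sup>* \<longleftrightarrow> dep i z \<le> dep i y"
proof
  assume "dep i z \<le> dep i y"
  have "z \<in> color_comp E i y" using color_comp_eq[OF assms(2)] assms(3) by simp
  from color_comp_chain[OF assms(1) this] show "(y, z) \<in> (E i)\<^sup>*"
  proof
    assume zy: "(z, y) \<in> (E i)\<^sup>*"
    then have "y = z" using path(1,2)[OF zy assms(1)] \<open>dep i z \<le> dep i y\<close> by simp
    then show ?thesis by simp
  qed
qed (rule path(1)[OF _ assms(1)])

lemma color_comp_trancl_iff:
  assumes "i \<in> I" "y \<in> color_comp E i x" "z \<in> color_comp E i x"
  shows "(y, z) \<in> (E i)\<^sup>+ \<longleftrightarrow> dep i z < dep i y"
proof
  assume "(y, z) \<in> (E i)\<^sup>+"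
  then obtain u where u: "(y, u) \<in> E i" "(u, z) \<in> (E i)\<^sup>*" by (meson tranclD)
  then show "dep i z < dep i y" using edge(3)[OF assms(1) u(1)] path(1)[OF u(2) assms(1)] by simp
next
  assume "dep i z < dep i y"
  then show "(y, z) \<in> (E i)\<^sup>+"
    using color_comp_path_iff[OF assms] by (metis less_imp_le less_irrefl rtranclD)
qed

text \<open>By (A2) one can go up while \<open>dep\<close> is positive and down while
  \<open>eps\<close> is positive, changing the depth by one each time.\<close>

lemma color_comp_exists:
  assumes "i \<in> I" "x \<in> X" "d \<le> eps i x + dep i x"
  shows "\<exists>y\<in>color_comp E i x. dep i y = d"
proof (cases "d \<le> dep i x")
  case True
  have "k \<le> dep i x \<Longrightarrow> \<exists>y\<in>color_comp E i x. dep i y = dep i x - k" for k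
  proof (induction k)
    case (Suc k)
    then obtain y where y: "y \<in> color_comp E i x" "dep i y = dep i x - k" by auto
    have "0 < dep i y" using y Suc by simp
    then obtain z where z: "(y, z) \<in> E i" using edge_up color_comp(1)[OF assms(1,2) y(1)] assms(1) by blast
    have "z \<in> color_comp E i x" using z by (intro color_comp_trans[OF y(1)] path_color_comp) auto
    then show ?case using edge(3)[OF assms(1) z] y by (intro bexI[of _ z]) auto
  qed (use color_comp_self in auto)
  from this[of "dep i x - d"] True show ?thesis by simp
next
  case False
  have "k \<le> eps i x \<Longrightarrow> \<exists>y\<in>color_comp E i x. dep i y = dep i x + k" for k
  proof (induction k)
    case (Suc k)
    then obtain y where y: "y \<in> color_comp E i x" "dep i y = dep i x + k" by auto
    have "0 < eps i y" using y Suc color_comp(2)[OF assms(1,2) y(1)] by simp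
    then obtain z where z: "(z, y) \<in> E i" using edge_down color_comp(1)[OF assms(1,2) y(1)] assms(1) by blast
    have "z \<in> color_comp E i y" using z by (intro color_comp_sym[OF path_color_comp]) auto
    then show ?case
      using edge(3)[OF assms(1) z] y by (intro bexI[of _ z] color_comp_trans[OF y(1)]) auto
  qed (use color_comp_self in auto)
  from this[of "d - dep i x"] False assms(3) show ?thesis by simp
qed

lemma rank_function_color_comp:
  assumes "i \<in> I" "x \<in> X"
  shows "rank_function (color_comp E i x) (E i) (eps i) (eps i x + dep i x)"
proof -
  have "eps i ` color_comp E i x = {0..eps i x + dep i x}"
  proof (intro antisym subsetI)
    fix n assume n: "n \<in> {0..eps i x + dep i x}"
    then obtain y where y: "y \<in> color_comp E i x" "dep i y = eps i x + dep i x - n"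
      using color_comp_exists[OF assms, of "eps i x + dep i x - n"] by auto
    then have "eps i y = n" using color_comp(2)[OF assms y(1)] n by simp
    then show "n \<in> eps i ` color_comp E i x" using y(1) by blast
  qed (use color_comp(2)[OF assms] in fastforce)
  then show ?thesis using edge(4)[OF assms(1)] by (auto simp: rank_function_def)
qed

text \<open>On a connected component two rank functions differ by a constant, and both take the
  least value 0.\<close>

lemma rank_function_color_comp_unique:
  assumes "i \<in> I" "x \<in> X" and r: "rank_function (color_comp E i x) (E i) r l"
  shows "r x = eps i x" "l = eps i x + dep i x"
proof -
  let ?C = "color_comp E i x" and ?L = "eps i x + dep i x"
  have img: "eps i ` ?C = {0..?L}" using rank_function_color_comp[OF assms(1,2)] by (simp add: rank_function_def)
  have img': "r ` ?C = {0..l}" using r by (simp add: rank_function_def)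
  have r_step: "r u + 1 = r v" if "u \<in> ?C" "v \<in> ?C" "(u, v) \<in> E i" for u v
    using r that by (simp add: rank_function_def)
  have shift: "r y + eps i x = eps i y + r x" if "y \<in> ?C" for y
    using that unfolding color_comp_def mem_Collect_eq
  proof (induction rule: rtrancl_induct)
    case (step u v)
    have uv: "u \<in> ?C" "v \<in> ?C"
      using step(1,2) by (auto simp: color_comp_def intro: rtrancl_into_rtrancl)
    from step(2) show ?case
    proof
      assume "(u, v) \<in> E i"
      then show ?thesis using edge(4)[OF assms(1)] r_step[OF uv] step(3) by fastforce
    next
      assume "(u, v) \<in> (E i)\<inverse>"
      then have "(v, u) \<in> E i" by simp
      then show ?thesis using edge(4)[OF assms(1)] r_step[OF uv(2,1)] step(3) by fastforce
    qed
  qed simp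
  have "0 \<in> eps i ` ?C" "?L \<in> eps i ` ?C" "0 \<in> r ` ?C" "l \<in> r ` ?C" by (simp_all add: img img')
  then obtain y0 y1 z0 z1 where y: "y0 \<in> ?C" "eps i y0 = 0" "y1 \<in> ?C" "eps i y1 = ?L"
    and z: "z0 \<in> ?C" "r z0 = 0" "z1 \<in> ?C" "r z1 = l"
    unfolding image_iff by (elim bexE) simp
  show eq: "r x = eps i x" using shift[OF y(1)] shift[OF z(1)] y z by simp
  have "r y1 \<le> l" "eps i z1 \<le> ?L"
    using imageI[OF y(3), of r] imageI[OF z(3), of "eps i"] by (simp_all add: img img')
  then show "l = ?L" using shift[OF y(3)] shift[OF z(3)] y z eq by simp
qed

section \<open>Poset invariants of the graph, expressed by the admissible system\<close>

lemma comp_rank: "i \<in> I \<Longrightarrow> x \<in> X \<Longrightarrow> comp_rank E i x = eps i x"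
  unfolding comp_rank_def
  by (rule the_equality) (use rank_function_color_comp rank_function_color_comp_unique(1) in blast)+

lemma comp_length: "i \<in> I \<Longrightarrow> x \<in> X \<Longrightarrow> comp_length E i x = eps i x + dep i x"
  unfolding comp_length_def
  by (rule the_equality) (use rank_function_color_comp rank_function_color_comp_unique(2) in blast)+

lemma depth_eq: "i \<in> I \<Longrightarrow> x \<in> X \<Longrightarrow> depth E i x = dep i x"
  by (simp add: depth_def comp_rank comp_length)

lemma wt_coeff_eq: "i \<in> I \<Longrightarrow> x \<in> X \<Longrightarrow> of_int (wt_coeff E i x) = pairing \<alpha> (\<mu> x) i"
  by (simp add: wt_coeff_def comp_rank depth_eq pairing_mu)

lemma wt_eq: "J \<subseteq> I \<Longrightarrow> x \<in> X \<Longrightarrow> wt \<alpha> J E x = weight_vec \<alpha> J (pairing \<alpha> (\<mu> x))"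
  unfolding wt_def weight_vec_def by (intro sum.cong) (auto simp: wt_coeff_eq)

lemma wt_full: "x \<in> X \<Longrightarrow> wt \<alpha> I E x = \<mu> x"
  using lattice by (simp add: wt_eq weight_vec_pairing weight_lattice_iff)

text \<open>The sum of the coefficients in \<open>simple_expansion\<close>: a grading that treats
  all colors alike.\<close>

definition height :: "real^'n \<Rightarrow> real" where
  "height v = (\<Sum>k\<in>I. 2 / (\<alpha> k \<bullet> \<alpha> k) * (v \<bullet> \<omega> k))"

lemma height_add_simple:
  assumes "i \<in> I" shows "height (v + \<alpha> i) = height v + 1"
proof -
  have "(\<Sum>k\<in>I. 2 / (\<alpha> k \<bullet> \<alpha> k) * (\<alpha> i \<bullet> \<omega> k)) = (\<Sum>k\<in>I. if k = i then 1 else 0)"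
    using assms simple_nonzero by (intro sum.cong) (auto simp: inner_simple_fund_weight)
  then show ?thesis
    using assms finite_I by (simp add: height_def inner_add_left distrib_left sum.distrib)
qed

lemma edge_height: "(u, v) \<in> (\<Union>i\<in>I. E i) \<Longrightarrow> height (\<mu> v) = height (\<mu> u) + 1"
  using edge(5) height_add_simple by auto

text \<open>Each edge raises the height by exactly 1, so the generated relation is antisymmetric and
  nothing fits strictly between the ends of an edge. Edges of different colors change the weight by
  different simple roots.\<close>

lemma colored_hasse_diagram_graph: "colored_hasse_diagram I X E"
proof -
  let ?D = "\<Union>i\<in>I. E i"
  define le where "le = {(x, y). x \<in> X \<and> y \<in> X \<and> (x, y) \<in> ?D\<^sup>*}"
  have DX: "s \<in> X" "t \<in> X" if "(s, t) \<in> ?D" for s t using that edge by auto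
  have up: "x = y \<or> height (\<mu> x) + 1 \<le> height (\<mu> y)" if "(x, y) \<in> ?D\<^sup>*" for x y
    using that by (induction rule: rtrancl_induct) (use edge_height in force)+
  have le: "x = y \<or> height (\<mu> x) + 1 \<le> height (\<mu> y)" if "(x, y) \<in> le" for x y
    using up that by (simp add: le_def)
  have "antisym le"
  proof (rule antisymI)
    fix x y assume "(x, y) \<in> le" "(y, x) \<in> le"
    then show "x = y" using le[of x y] le[of y x] by auto
  qed
  then have "partial_order_on X le"
    by (auto simp: order_on_defs refl_on_def trans_def le_def intro: rtrancl_trans)
  moreover have "?D = covers le"
  proof (intro antisym subrelI)
    fix s t assume st: "(s, t) \<in> ?D"
    have "(s, t) \<in> le" using st DX[OF st] by (auto simp: le_def)
    moreover have "\<not> ((s, u) \<in> le \<and> (u, t) \<in> le \<and> u \<noteq> s \<and> u \<noteq> t)" for u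
      using le[of s u] le[of u t] edge_height[OF st] by auto
    moreover have "s \<noteq> t" using edge_height[OF st] by auto
    ultimately show "(s, t) \<in> covers le" by (simp add: covers_def)
  next
    fix s t assume "(s, t) \<in> covers le"
    then have st: "(s, t) \<in> ?D\<^sup>*" "s \<noteq> t" "s \<in> X" "t \<in> X"
      and no: "\<And>u. (s, u) \<in> le \<Longrightarrow> (u, t) \<in> le \<Longrightarrow> u = s \<or> u = t"
      by (auto simp: covers_def le_def)
    from st(1,2) obtain u where u: "(s, u) \<in> ?D" "(u, t) \<in> ?D\<^sup>*" by (meson converse_rtranclE)
    have "u \<noteq> s" using edge_height[OF u(1)] by auto
    moreover have "(s, u) \<in> le" "(u, t) \<in> le"
      using u DX[OF u(1)] st unfolding le_def by (auto intro: r_into_rtrancl)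
    ultimately have "u = t" using no by blast
    then show "(s, t) \<in> ?D" using u(1) by simp
  qed
  moreover have "E i \<inter> E j = {}" if "i \<in> I" "j \<in> I" "i \<noteq> j" for i j
  proof -
    have "\<alpha> i \<noteq> \<alpha> j" using inj_simple that by (auto simp: inj_on_def)
    then show ?thesis using edge(5)[OF that(1)] edge(5)[OF that(2)] by force
  qed
  ultimately show ?thesis unfolding colored_hasse_diagram_def by blast
qed

lemma Phi_structured_graph: "Phi_structured_poset \<alpha> I X E"
proof -
  have "ranked X (\<Union>i\<in>I. E i)"
    using finite_X edge(1,2) edge_height
    by (intro ranked_if_graded[where h = "\<lambda>x. height (\<mu> x)"]) auto
  moreover have "wt \<alpha> I E s + \<alpha> i = wt \<alpha> I E t" if "i \<in> I" "(s, t) \<in> E i" for i s t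
    using edge[OF that] by (simp add: wt_full)
  ultimately show ?thesis
    unfolding Phi_structured_poset_def using finite_X colored_hasse_diagram_graph by blast
qed

lemma fibrous_graph: "fibrous I X E"
  unfolding fibrous_def by (intro ballI) (simp add: color_comp_path_iff linear)

end

section \<open>Timing patterns and colorings\<close>

context admissible
begin

lemma K_set_eq: "J \<subseteq> I \<Longrightarrow> x \<in> X \<Longrightarrow> K_set E J \<nu> x = {j \<in> J. \<nu> j < dep j x}"
  by (auto simp: K_set_def depth_eq subset_iff)

lemma not_in_M_set_iff: "J \<subseteq> I \<Longrightarrow> x \<in> X \<Longrightarrow> x \<notin> M_set X E J \<nu> \<longleftrightarrow> K_set E J \<nu> x \<noteq> {}"
  by (auto simp: K_set_eq M_set_def depth_eq subset_iff not_le)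

lemma color_comp_ex1:
  assumes "i \<in> I" "x \<in> X" "d \<le> eps i x + dep i x"
  shows "\<exists>!y. y \<in> color_comp E i x \<and> dep i y = d"
  using color_comp_exists[OF assms] color_comp_inj[OF assms(1)] by blast

lemma marked_elt:
  assumes "i \<in> I" "x \<in> X" "\<nu> i < dep i x"
  shows "marked_elt E \<nu> x i \<in> color_comp E i x" "dep i (marked_elt E \<nu> x i) = \<nu> i + 1"
proof -
  have "(\<lambda>y. y \<in> color_comp E i x \<and> depth E i y = \<nu> i + 1)
      = (\<lambda>y. y \<in> color_comp E i x \<and> dep i y = \<nu> i + 1)"
    using color_comp(1)[OF assms(1,2)] depth_eq[OF assms(1)] by (intro ext) auto
  then have "marked_elt E \<nu> x i \<in> color_comp E i x \<and> dep i (marked_elt E \<nu> x i) = \<nu> i + 1"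
    unfolding marked_elt_def using theI'[OF color_comp_ex1[OF assms(1,2), of "\<nu> i + 1"]] assms(3) by simp
  then show "marked_elt E \<nu> x i \<in> color_comp E i x" "dep i (marked_elt E \<nu> x i) = \<nu> i + 1" by auto
qed

lemma marked_elt_eqI:
  assumes "i \<in> I" "x \<in> X" "\<nu> i < dep i x" "y \<in> color_comp E i x" "dep i y = \<nu> i + 1"
  shows "marked_elt E \<nu> x i = y"
  using marked_elt[where \<nu> = \<nu>, OF assms(1-3)] assms(4,5) by (intro color_comp_inj[OF assms(1)]) auto

lemma marked_elt_cong:
  assumes "y \<in> color_comp E i x"
  shows "marked_elt E \<nu> y i = marked_elt E \<nu> x i"
  using color_comp_eq[OF assms] by (simp add: marked_elt_def)

text \<open>The elements strictly above \<open>y\<close> in its string have the depths below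
  \<open>dep i y\<close>, each exactly once.\<close>

lemma U_set_iff:
  assumes "i \<in> I" "x \<in> X" "y \<in> color_comp E i x"
  shows "y \<in> U_set E i x p \<longleftrightarrow> dep i y \<le> p"
proof -
  have "bij_betw (dep i) {z \<in> color_comp E i x. (y, z) \<in> (E i)\<^sup>+} {..<dep i y}"
    unfolding bij_betw_def
  proof
    show "inj_on (dep i) {z \<in> color_comp E i x. (y, z) \<in> (E i)\<^sup>+}"
      using color_comp_inj[OF assms(1)] by (intro inj_onI) auto
    have "\<exists>z\<in>color_comp E i x. dep i z = d" if "d < dep i y" for d
      using color_comp_exists[OF assms(1,2), of d] color_comp(2)[OF assms] that by linarith
    then show "dep i ` {z \<in> color_comp E i x. (y, z) \<in> (E i)\<^sup>+} = {..<dep i y}"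
      using color_comp_trancl_iff[OF assms(1,3)] by (auto simp: image_iff)
  qed
  then have "card {z \<in> color_comp E i x. (y, z) \<in> (E i)\<^sup>+} = dep i y"
    by (simp add: bij_betw_same_card)
  then show ?thesis using assms(3) by (simp add: U_set_def less_Suc_eq_le)
qed

lemma F_below_iff: "F_below F i x y \<longleftrightarrow> (x, y) \<in> (E i)\<^sup>*"
proof -
  have "F_graph F i = (E i)\<inverse>" by (auto simp: F_graph_def G_graph_def)
  then show ?thesis by (simp add: F_below_def rtrancl_power[symmetric] rtrancl_converse)
qed

context
  fixes t :: "'x \<Rightarrow> 'i \<Rightarrow> real" and ord :: "'i rel" and J :: "'i set" and \<nu> :: "'i \<Rightarrow> nat"
  assumes timing: "coherent_timing_pattern \<alpha> I X dbar F t"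
    and ord: "linear_order_on I ord"
    and J: "J \<subseteq> I"
begin

abbreviation K :: "'x \<Rightarrow> 'i set" where "K \<equiv> K_set E J \<nu>"
abbreviation \<kappa> :: "'x \<Rightarrow> 'i" where "\<kappa> \<equiv> timing_coloring E ord t J \<nu>"

text \<open>The quantity minimised by the coloring. It is consulted for \<open>k\<close> in
  \<open>K x\<close>, where the marked element lies at or above \<open>x\<close>.\<close>

definition \<tau> :: "'x \<Rightarrow> 'i \<Rightarrow> real" where "\<tau> x k = t (marked_elt E \<nu> x k) k"

lemma dbar_negative_iff: "x \<in> X \<Longrightarrow> i \<in> I \<Longrightarrow> pairing \<alpha> (dbar x) i < 0 \<longleftrightarrow> 0 < dep i x"
  using real_dep[of x i] by linarith

lemma timing_edge:
  assumes "i \<in> I" "(y, x) \<in> E i" "0 < dep i x"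
  shows "t x i \<le> t y i"
    and "k \<in> I \<Longrightarrow> k \<noteq> i \<Longrightarrow> d < 0 \<Longrightarrow> r \<le> t x i \<Longrightarrow>
      (\<exists>z\<in>X. F_below F k x z \<and> pairing \<alpha> (dbar z) k = of_int d \<and> t z k = r) \<longleftrightarrow>
      (\<exists>z\<in>X. F_below F k y z \<and> pairing \<alpha> (dbar z) k = of_int d \<and> t z k = r)"
proof -
  have "pairing \<alpha> (dbar x) i < 0" "x \<in> X" "F i x = Some y"
    using edge(1)[OF assms(1,2)] assms by (simp_all add: dbar_negative_iff edge_iff)
  then have *: "t x i \<le> t y i \<and>
        (\<forall>j\<in>I. \<forall>d :: int. \<forall>s :: real. j \<noteq> i \<and> d < 0 \<and> s \<le> t x i \<longrightarrow>
           ((\<exists>z\<in>X. F_below F j x z \<and> pairing \<alpha> (dbar z) j = of_int d \<and> t z j = s) \<longleftrightarrow>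
            (\<exists>z\<in>X. F_below F j y z \<and> pairing \<alpha> (dbar z) j = of_int d \<and> t z j = s)))"
    using timing assms(1) unfolding coherent_timing_pattern_def by blast
  then show "t x i \<le> t y i" by blast
  show "(\<exists>z\<in>X. F_below F k x z \<and> pairing \<alpha> (dbar z) k = of_int d \<and> t z k = r) \<longleftrightarrow>
      (\<exists>z\<in>X. F_below F k y z \<and> pairing \<alpha> (dbar z) k = of_int d \<and> t z k = r)"
    if "k \<in> I" "k \<noteq> i" "d < 0" "r \<le> t x i"
    using * that by simp
qed

lemma timing_path:
  assumes "i \<in> I" "(x, m) \<in> (E i)\<^sup>*" "0 < dep i m"
  shows "t m i \<le> t x i"
  using assms(2)
proof (induction rule: converse_rtrancl_induct)
  case (step y z)
  have "0 < dep i z" using path(1)[OF step(2) assms(1)] assms(3) by simp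
  then show ?case using timing_edge(1)[OF assms(1) step(1)] step(3) by simp
qed simp

text \<open>The bridge to coherence: the right-hand side is the existential of the coherence
  condition for \<open>d = - (\<nu> k + 1)\<close>. An element of depth \<open>\<nu> k + 1\<close>
  at or above \<open>x\<close> exists iff \<open>dep k x\<close> exceeds \<open>\<nu> k\<close>, and
  then it is the marked one.\<close>

lemma in_K_iff:
  assumes "x \<in> X" "k \<in> J"
  shows "k \<in> K x \<and> \<tau> x k = r \<longleftrightarrow>
    (\<exists>z\<in>X. F_below F k x z \<and> pairing \<alpha> (dbar z) k = of_int (- int (\<nu> k + 1)) \<and> t z k = r)"
proof -
  have kI: "k \<in> I" using assms J by blast
  have dep_iff: "pairing \<alpha> (dbar z) k = of_int (- int (\<nu> k + 1)) \<longleftrightarrow> dep k z = \<nu> k + 1" if "z \<in> X" for z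
    using real_dep[OF that kI] by (auto simp: algebra_simps)
  show ?thesis
  proof
    assume "k \<in> K x \<and> \<tau> x k = r"
    then have lt: "\<nu> k < dep k x" and r: "\<tau> x k = r" using assms J by (auto simp: K_set_eq)
    note m = marked_elt[where \<nu> = \<nu>, OF kI assms(1) lt]
    have "(x, marked_elt E \<nu> x k) \<in> (E k)\<^sup>*"
      using color_comp_path_iff[OF kI color_comp_self m(1)] m(2) lt by simp
    moreover have "marked_elt E \<nu> x k \<in> X" by (rule color_comp(1)[OF kI assms(1) m(1)])
    ultimately show "\<exists>z\<in>X. F_below F k x z \<and> pairing \<alpha> (dbar z) k = of_int (- int (\<nu> k + 1)) \<and> t z k = r"
      using m(2) r dep_iff by (intro bexI[of _ "marked_elt E \<nu> x k"]) (simp_all add: F_below_iff \<tau>_def)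
  next
    assume "\<exists>z\<in>X. F_below F k x z \<and> pairing \<alpha> (dbar z) k = of_int (- int (\<nu> k + 1)) \<and> t z k = r"
    then obtain z where z: "z \<in> X" "(x, z) \<in> (E k)\<^sup>*" "dep k z = \<nu> k + 1" "t z k = r"
      using dep_iff by (auto simp: F_below_iff)
    have lt: "\<nu> k < dep k x" using path(1)[OF z(2) kI] z(3) by simp
    have "marked_elt E \<nu> x k = z" by (rule marked_elt_eqI[where \<nu> = \<nu>, OF kI assms(1) lt path_color_comp[OF z(2)] z(3)])
    then show "k \<in> K x \<and> \<tau> x k = r" using z(4) lt assms J by (auto simp: K_set_eq \<tau>_def)
  qed
qed

text \<open>The minimum with its tie-break, unfolded into separate comparisons with each rival
  color, so that two vertices can be compared color by color.\<close>

definition selected :: "'x \<Rightarrow> 'i \<Rightarrow> bool" where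
  "selected x j \<longleftrightarrow> j \<in> K x \<and> (\<forall>k\<in>K x. \<tau> x j < \<tau> x k \<or> \<tau> x j = \<tau> x k \<and> (j, k) \<in> ord)"

lemma timing_coloring_eq_iff:
  assumes "K x \<noteq> {}"
  shows "\<kappa> x = j \<longleftrightarrow> selected x j"
proof -
  let ?m = "Min (\<tau> x ` K x)"
  let ?S = "{i \<in> K x. \<tau> x i = ?m}"
  have KI: "K x \<subseteq> I" using J by (auto simp: K_set_def)
  then have fin: "finite (\<tau> x ` K x)" using finite_I finite_subset by blast
  have "?m \<in> \<tau> x ` K x" using fin assms by (intro Min_in) auto
  then have "?S \<noteq> {}" by auto
  then have "\<kappa> x = j \<longleftrightarrow> j \<in> ?S \<and> (\<forall>k\<in>?S. (j, k) \<in> ord)"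
    unfolding timing_coloring_def \<tau>_def[symmetric] using KI finite_I
    by (intro least_wrt_eq_iff[OF ord]) (auto intro: finite_subset)
  also have "\<dots> \<longleftrightarrow> selected x j"
  proof
    assume L: "j \<in> ?S \<and> (\<forall>k\<in>?S. (j, k) \<in> ord)"
    have "\<tau> x j < \<tau> x k \<or> \<tau> x j = \<tau> x k \<and> (j, k) \<in> ord" if "k \<in> K x" for k
      using L that Min_le[OF fin, of "\<tau> x k"] by force
    then show "selected x j" using L by (simp add: selected_def)
  next
    assume R: "selected x j"
    then have "?m = \<tau> x j" using fin
      by (intro Min_eqI) (auto simp: selected_def intro: less_imp_le)
    then show "j \<in> ?S \<and> (\<forall>k\<in>?S. (j, k) \<in> ord)" using R by (auto simp: selected_def)
  qed
  finally show ?thesis .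
qed

text \<open>Up to the time \<open>t x j\<close>, which is not earlier than that of the marked element, coherence
  makes the other colors behave in the same way at \<open>x\<close> and at \<open>F j x\<close>.\<close>

lemma selected_edge:
  assumes "j \<in> J" "(y, x) \<in> E j" "\<nu> j < dep j x"
  shows "selected x j \<longleftrightarrow> selected y j"
proof -
  have jI: "j \<in> I" using assms J by blast
  note e = edge[OF jI assms(2)]
  have yx: "y \<in> color_comp E j x"
    using assms(2) by (intro color_comp_sym[OF path_color_comp]) auto
  have jK: "j \<in> K x" "j \<in> K y" using assms J e by (auto simp: K_set_eq)
  have \<tau>_eq: "\<tau> y j = \<tau> x j" by (simp add: \<tau>_def marked_elt_cong[OF yx])
  note m = marked_elt[where \<nu> = \<nu>, OF jI e(1) assms(3)]
  have le: "\<tau> x j \<le> t x j"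
    unfolding \<tau>_def using color_comp_path_iff[OF jI color_comp_self m(1)] m(2) assms(3)
    by (intro timing_path[OF jI]) auto
  have other: "k \<in> K x \<and> \<tau> x k = r \<longleftrightarrow> k \<in> K y \<and> \<tau> y k = r"
    if "k \<in> J" "k \<noteq> j" "r \<le> \<tau> x j" for k r
  proof -
    have "k \<in> I" "r \<le> t x j" using that J le by auto
    then show ?thesis
      unfolding in_K_iff[OF e(1) that(1)] in_K_iff[OF e(2) that(1)]
      using assms(3) by (intro timing_edge(2)[OF jI assms(2) _ _ that(2)]) auto
  qed
  have ord_refl: "(j, j) \<in> ord" using ord jI by (auto simp: order_on_defs refl_on_def)
  \<comment> \<open>Rival colors are examined only at times up to \<open>\<tau> x j\<close>, the
    range in which \<open>other\<close> transfers information. Equality is included because ties are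
    decided by \<open>ord\<close>.\<close>
  have sel: "selected z j \<longleftrightarrow>
      (\<forall>k\<in>J - {j}. \<forall>r\<le>\<tau> x j. k \<in> K z \<and> \<tau> z k = r \<longrightarrow> \<tau> x j = r \<and> (j, k) \<in> ord)"
    if "j \<in> K z" "\<tau> z j = \<tau> x j" for z
  proof -
    have KJ: "K z \<subseteq> J" by (auto simp: K_set_def)
    have "selected z j \<longleftrightarrow> (\<forall>k\<in>K z. \<tau> x j < \<tau> z k \<or> \<tau> x j = \<tau> z k \<and> (j, k) \<in> ord)"
      using that by (simp add: selected_def)
    also have "\<dots> \<longleftrightarrow> (\<forall>k\<in>K z - {j}. \<tau> x j < \<tau> z k \<or> \<tau> x j = \<tau> z k \<and> (j, k) \<in> ord)"
      using that ord_refl by auto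
    also have "\<dots> \<longleftrightarrow> (\<forall>k\<in>J - {j}. \<forall>r\<le>\<tau> x j. k \<in> K z \<and> \<tau> z k = r \<longrightarrow> \<tau> x j = r \<and> (j, k) \<in> ord)"
      using KJ by (auto simp: not_le[symmetric])
    finally show ?thesis .
  qed
  show ?thesis
    unfolding sel[OF jK(1) refl] sel[OF jK(2) \<tau>_eq] using other by (intro ball_cong refl) auto
qed

lemma selected_color_comp:
  assumes "j \<in> J" "x \<in> X" "y \<in> color_comp E j x" "\<nu> j < dep j x" "\<nu> j < dep j y"
  shows "selected x j \<longleftrightarrow> selected y j"
proof -
  have jI: "j \<in> I" using assms J by blast
  have *: "selected u j \<longleftrightarrow> selected v j" if "(u, v) \<in> (E j)\<^sup>*" "\<nu> j < dep j v" for u v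
    using that(1)
  proof (induction rule: converse_rtrancl_induct)
    case (step u w)
    have "\<nu> j < dep j w" using path(1)[OF step(2) jI] that(2) by simp
    then show ?case using selected_edge[OF assms(1) step(1)] step(3) by simp
  qed simp
  show ?thesis using color_comp_chain[OF jI assms(3)] *[of x y] *[of y x] assms(4,5) by blast
qed

lemma timing_coloring_in_K:
  assumes "x \<in> X - M_set X E J \<nu>"
  shows "\<kappa> x \<in> J" "\<nu> (\<kappa> x) < dep (\<kappa> x) x" "selected x (\<kappa> x)"
proof -
  have "K x \<noteq> {}" using assms not_in_M_set_iff[OF J] by blast
  then show "selected x (\<kappa> x)" using timing_coloring_eq_iff by blast
  then have "\<kappa> x \<in> K x" by (simp add: selected_def)
  then show "\<kappa> x \<in> J" "\<nu> (\<kappa> x) < dep (\<kappa> x) x" using assms J by (auto simp: K_set_eq)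
qed

text \<open>Both the coloring property and the cancellation of alternants rest on this description
  of the part of a string that has its own color.\<close>

lemma timing_coloring_color_comp:
  assumes "x \<in> X - M_set X E J \<nu>" "y \<in> color_comp E (\<kappa> x) x"
  shows "y \<notin> M_set X E J \<nu> \<and> \<kappa> y = \<kappa> x \<longleftrightarrow> \<nu> (\<kappa> x) < dep (\<kappa> x) y"
proof -
  note k = timing_coloring_in_K[OF assms(1)]
  have I: "\<kappa> x \<in> I" and xX: "x \<in> X" using k J assms by auto
  have yX: "y \<in> X" by (rule color_comp(1)[OF I xX assms(2)])
  show ?thesis
  proof
    assume "y \<notin> M_set X E J \<nu> \<and> \<kappa> y = \<kappa> x"
    then show "\<nu> (\<kappa> x) < dep (\<kappa> x) y" using timing_coloring_in_K(2)[of y] yX by auto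
  next
    assume lt: "\<nu> (\<kappa> x) < dep (\<kappa> x) y"
    then have ne: "K y \<noteq> {}" using k(1) yX J by (auto simp: K_set_eq)
    have "selected y (\<kappa> x)"
      using selected_color_comp[OF k(1) xX assms(2) k(2) lt] k(3) by simp
    then show "y \<notin> M_set X E J \<nu> \<and> \<kappa> y = \<kappa> x"
      using ne timing_coloring_eq_iff[OF ne] not_in_M_set_iff[OF J yX] by simp
  qed
qed

lemma J_nu_coloring_timing_coloring: "J_nu_coloring X E J \<nu> \<kappa>"
  unfolding J_nu_coloring_def
proof (intro ballI conjI)
  fix x assume x: "x \<in> X - M_set X E J \<nu>"
  show "\<kappa> x \<in> J" by (rule timing_coloring_in_K[OF x])
  then have I: "\<kappa> x \<in> I" using J by blast
  show "{y \<in> color_comp E (\<kappa> x) x. y \<notin> M_set X E J \<nu> \<and> \<kappa> y = \<kappa> x}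
      = color_comp E (\<kappa> x) x - U_set E (\<kappa> x) x (\<nu> (\<kappa> x))"
  proof (rule set_eqI)
    fix y
    show "y \<in> {y \<in> color_comp E (\<kappa> x) x. y \<notin> M_set X E J \<nu> \<and> \<kappa> y = \<kappa> x} \<longleftrightarrow>
        y \<in> color_comp E (\<kappa> x) x - U_set E (\<kappa> x) x (\<nu> (\<kappa> x))"
      using timing_coloring_color_comp[OF x, of y] U_set_iff[OF I, of x y] x
      by (cases "y \<in> color_comp E (\<kappa> x) x") (simp_all add: not_le)
  qed
qed

end

section \<open>Moving along a string by prescribing the depth\<close>

definition chain_elt :: "'i \<Rightarrow> 'x \<Rightarrow> nat \<Rightarrow> 'x" where
  "chain_elt i x d = (THE y. y \<in> color_comp E i x \<and> dep i y = d)"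

lemma chain_elt:
  assumes "i \<in> I" "x \<in> X" "d \<le> eps i x + dep i x"
  shows "chain_elt i x d \<in> color_comp E i x" "chain_elt i x d \<in> X" "dep i (chain_elt i x d) = d"
    "eps i (chain_elt i x d) = eps i x + dep i x - d"
proof -
  have *: "chain_elt i x d \<in> color_comp E i x \<and> dep i (chain_elt i x d) = d"
    unfolding chain_elt_def by (rule theI'[OF color_comp_ex1[OF assms]])
  then show c: "chain_elt i x d \<in> color_comp E i x" and d: "dep i (chain_elt i x d) = d" by auto
  show "chain_elt i x d \<in> X" by (rule color_comp(1)[OF assms(1,2) c])
  show "eps i (chain_elt i x d) = eps i x + dep i x - d"
    using color_comp(2)[OF assms(1,2) c] d by simp
qed

lemma chain_elt_eqI:
  assumes "i \<in> I" "y \<in> color_comp E i x"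
  shows "chain_elt i x (dep i y) = y"
  unfolding chain_elt_def using assms color_comp_inj[OF assms(1)] by (intro the_equality) auto

lemma chain_elt_chain_elt:
  assumes "i \<in> I" "x \<in> X" "d \<le> eps i x + dep i x" "d' = dep i x"
  shows "chain_elt i (chain_elt i x d) d' = x"
  using chain_elt_eqI[OF assms(1) color_comp_sym[OF chain_elt(1)[OF assms(1-3)]]] assms(4) by simp

text \<open>The full weight moves by a multiple of \<open>\<alpha> i\<close>. As \<open>i\<close> is
  in \<open>J\<close>, this vector lies in the span of the \<open>J\<close>-roots, where pairings
  decide equality.\<close>

lemma wt_chain_elt:
  assumes "J \<subseteq> I" "i \<in> J" "x \<in> X" "d \<le> eps i x + dep i x"
  shows "wt \<alpha> J E (chain_elt i x d) = wt \<alpha> J E x + (real (dep i x) - real d) *\<^sub>R \<alpha> i"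
proof -
  interpret J: based_root_system "root_subsystem \<Phi> \<alpha> J" J \<alpha>
    by (rule based_root_system_subsystem[OF based_root_system_axioms assms(1)])
  have iI: "i \<in> I" using assms by blast
  note c = chain_elt[OF iI assms(3,4)]
  have "\<mu> (chain_elt i x d) = \<mu> x + (real (dep i x) - real d) *\<^sub>R \<alpha> i"
    using color_comp(3)[OF iI assms(3) c(1)] c(3) by (simp add: algebra_simps)
  then show ?thesis
    unfolding wt_eq[OF assms(1,3)] wt_eq[OF assms(1) c(2)]
    by (intro J.span_eqI span_add span_scale J.weight_vec_span J.simple_in_span assms)
       (simp_all add: J.pairing_weight_vec pairing_add pairing_scale)
qed

lemma pairing_wt:
  assumes "J \<subseteq> I" "i \<in> J" "x \<in> X"
  shows "pairing \<alpha> (wt \<alpha> J E x) i = real (eps i x) - real (dep i x)"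
proof -
  interpret J: based_root_system "root_subsystem \<Phi> \<alpha> J" J \<alpha>
    by (rule based_root_system_subsystem[OF based_root_system_axioms assms(1)])
  have "i \<in> I" using assms by blast
  then show ?thesis
    by (simp add: wt_eq[OF assms(1,3)] J.pairing_weight_vec[OF assms(2)] pairing_mu assms(3))
qed

lemma wt_lattice: "wt \<alpha> J E x \<in> weight_lattice \<alpha> J"
  by (auto simp: wt_def weight_lattice_def)

lemma restrict_elt_WGF:
  assumes "J \<subseteq> I"
  shows "restrict_elt \<alpha> J (WGF \<alpha> I X E) = (\<Sum>x\<in>X. Poly_Mapping.single (wt \<alpha> J E x) 1)"
  unfolding WGF_def restrict_elt_sum_single[OF finite_X]
  by (intro sum.cong refl) (simp add: restrict_weight_def wt_full wt_eq[OF assms])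

end

section \<open>Crystalline splitting\<close>

context admissible
begin

lemma dominant_add_wt:
  assumes "J \<subseteq> I" "m \<in> M_set X E J \<nu>"
  shows "weight_vec \<alpha> J (\<lambda>j. of_nat (\<nu> j)) + wt \<alpha> J E m \<in> dominant_weights \<alpha> J"
proof -
  interpret J: based_root_system "root_subsystem \<Phi> \<alpha> J" J \<alpha>
    by (rule based_root_system_subsystem[OF based_root_system_axioms assms(1)])
  have m: "m \<in> X" "\<And>j. j \<in> J \<Longrightarrow> dep j m \<le> \<nu> j"
    using assms by (auto simp: M_set_def depth_eq subset_iff)
  have "weight_vec \<alpha> J (\<lambda>j. of_nat (\<nu> j)) + wt \<alpha> J E m \<in> weight_lattice \<alpha> J"
    by (rule J.weight_lattice_add[OF _ wt_lattice])
       (simp add: J.weight_lattice_iff J.weight_vec_span J.pairing_weight_vec)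
  moreover have "0 \<le> real (\<nu> j) + (real (eps j m) - real (dep j m))" if "j \<in> J" for j
    using m(2)[OF that] by simp
  ultimately show ?thesis
    using m(1) by (simp add: J.dominant_weights_iff pairing_add J.pairing_weight_vec pairing_wt[OF assms(1)])
qed

text \<open>In each string, the part of color \<open>i\<close> below the mark is symmetric under the reflection
  \<open>\<sigma> i\<close> shifted by \<open>\<rho>\<close>, so the elements outside of \<open>M_set\<close> cancel in pairs.\<close>

lemma bialternant_mult_WGF:
  assumes J: "J \<subseteq> I"
  shows "bialternant_sub \<Phi> \<alpha> J (weight_vec \<alpha> J (\<lambda>j. of_nat (\<nu> j))) * restrict_elt \<alpha> J (WGF \<alpha> I X E)
    = (\<Sum>m\<in>M_set X E J \<nu>. bialternant_sub \<Phi> \<alpha> J (weight_vec \<alpha> J (\<lambda>j. of_nat (\<nu> j)) + wt \<alpha> J E m))"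
proof -
  interpret J: based_root_system "root_subsystem \<Phi> \<alpha> J" J \<alpha>
    by (rule based_root_system_subsystem[OF based_root_system_axioms J])
  let ?\<nu> = "weight_vec \<alpha> J (\<lambda>j. real (\<nu> j))" and ?M = "M_set X E J \<nu>" and ?g = "wt \<alpha> J E"
  obtain t where t: "coherent_timing_pattern \<alpha> I X dbar F t" using timing_exists by blast
  \<comment> \<open>The identity does not mention an order, so any linear order can serve to break
    ties.\<close>
  obtain ord where ord: "linear_order_on I ord"
    using well_order_on[of I] by (auto simp: well_order_on_def)
  define \<kappa> where "\<kappa> = timing_coloring E ord t J \<nu>"
  \<comment> \<open>The image has \<open>eps\<close> equal to \<open>dep - \<nu> - 1\<close>, taken
    at \<open>x\<close> and its color; a second application therefore returns to the depth of
    \<open>x\<close>.\<close>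
  define \<psi> where "\<psi> x = chain_elt (\<kappa> x) x (\<nu> (\<kappa> x) + 1 + eps (\<kappa> x) x)" for x
  note \<kappa> = timing_coloring_in_K(1,2)[OF t ord J, of _ \<nu>, folded \<kappa>_def]
  note \<kappa>_comp = timing_coloring_color_comp[OF t ord J, of _ \<nu>, folded \<kappa>_def]
  have \<psi>: "\<psi> x \<in> X - ?M \<and> \<psi> (\<psi> x) = x \<and> ?\<nu> + ?g (\<psi> x) + J.\<rho> = J.\<sigma> (\<kappa> x) (?\<nu> + ?g x + J.\<rho>)"
    if x: "x \<in> X - ?M" for x
  proof -
    have xX: "x \<in> X" and j: "\<kappa> x \<in> J" "\<kappa> x \<in> I" and lt: "\<nu> (\<kappa> x) < dep (\<kappa> x) x"
      using x \<kappa>[OF x] J by auto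
    have le: "\<nu> (\<kappa> x) + 1 + eps (\<kappa> x) x \<le> eps (\<kappa> x) x + dep (\<kappa> x) x" using lt by simp
    note c = chain_elt[OF j(2) xX le, folded \<psi>_def]
    have M: "\<psi> x \<notin> ?M" and same: "\<kappa> (\<psi> x) = \<kappa> x" using \<kappa>_comp[OF x c(1)] c(3) by auto
    have "\<psi> (\<psi> x) = chain_elt (\<kappa> x) (\<psi> x) (\<nu> (\<kappa> x) + 1 + eps (\<kappa> x) (\<psi> x))"
      unfolding \<psi>_def[of "\<psi> x"] same ..
    also have "\<dots> = x"
      unfolding \<psi>_def[of x] using c(4)[unfolded \<psi>_def] lt
      by (intro chain_elt_chain_elt[OF j(2) xX le]) simp
    finally have inv: "\<psi> (\<psi> x) = x" .
    have "?g (\<psi> x) = ?g x + (real (dep (\<kappa> x) x) - real (\<nu> (\<kappa> x) + 1 + eps (\<kappa> x) x)) *\<^sub>R \<alpha> (\<kappa> x)"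
      unfolding \<psi>_def by (rule wt_chain_elt[OF J j(1) xX le])
    then have "?\<nu> + ?g (\<psi> x) + J.\<rho> = J.\<sigma> (\<kappa> x) (?\<nu> + ?g x + J.\<rho>)"
      using j(1)
      by (simp add: simple_reflection pairing_add J.pairing_weight_vec J.pairing_weyl_vector
          pairing_wt[OF J _ xX] algebra_simps)
    then show ?thesis using c(2) M inv by simp
  qed
  have simple: "\<exists>\<phi>. bij_betw \<phi> X X \<and> (\<forall>x\<in>X. ?g (\<phi> x) = J.\<sigma> i (?g x))" if i: "i \<in> J" for i
  proof -
    have iI: "i \<in> I" using i J by blast
    \<comment> \<open>Taking \<open>eps\<close> as the new depth exchanges \<open>eps\<close> and
      \<open>dep\<close>, which negates the coefficient of the weight at color
      \<open>i\<close>.\<close>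
    define \<phi> where "\<phi> x = chain_elt i x (eps i x)" for x
    have \<phi>: "\<phi> x \<in> X \<and> \<phi> (\<phi> x) = x \<and> ?g (\<phi> x) = J.\<sigma> i (?g x)" if x: "x \<in> X" for x
    proof -
      note c = chain_elt[OF iI x, of "eps i x", simplified]
      have "\<phi> (\<phi> x) = x"
        unfolding \<phi>_def c(4) using chain_elt_chain_elt[OF iI x] by simp
      moreover have "?g (\<phi> x) = J.\<sigma> i (?g x)"
        unfolding \<phi>_def using wt_chain_elt[OF J i x, of "eps i x"]
        by (simp add: simple_reflection pairing_wt[OF J i x] algebra_simps)
      ultimately show ?thesis using c(2) by (simp add: \<phi>_def)
    qed
    then have "bij_betw \<phi> X X" by (intro bij_betw_byWitness[where f' = \<phi>]) auto
    then show ?thesis using \<phi> by blast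
  qed
  have dom: "?\<nu> \<in> dominant_weights \<alpha> J"
    by (simp add: J.dominant_weights_iff J.weight_lattice_iff J.weight_vec_span J.pairing_weight_vec)
  have bij: "bij_betw \<psi> (X - ?M) (X - ?M)"
    using \<psi> by (intro bij_betw_byWitness[where f' = \<psi>]) auto
  have "?M \<subseteq> X" by (auto simp: M_set_def)
  then show ?thesis
    unfolding restrict_elt_WGF[OF J]
    using J.bialternant_mult_invariant[OF dom finite_X simple _ dominant_add_wt[OF J] bij] \<psi> \<kappa>(1)
    by blast
qed

lemma crystalline_splitting_graph: "crystalline_splitting_poset \<Phi> \<alpha> I X E"
proof -
  have "\<exists>S\<subseteq>X. (\<forall>s\<in>S. \<nu> + wt \<alpha> J E s \<in> dominant_weights \<alpha> J) \<and>
      bialternant_sub \<Phi> \<alpha> J \<nu> * restrict_elt \<alpha> J (WGF \<alpha> I X E)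
        = (\<Sum>s\<in>S. bialternant_sub \<Phi> \<alpha> J (\<nu> + wt \<alpha> J E s))"
    if J: "J \<subseteq> I" and dom: "\<nu> \<in> dominant_weights \<alpha> J" for J \<nu>
  proof -
    obtain c :: "'i \<Rightarrow> nat" where \<nu>: "\<nu> = weight_vec \<alpha> J (\<lambda>j. of_nat (c j))"
      using dom by (auto simp: dominant_weights_def)
    show ?thesis
      using dominant_add_wt[OF J] bialternant_mult_WGF[OF J]
      by (intro exI[of _ "M_set X E J c"]) (auto simp: \<nu> M_set_def)
  qed
  then show ?thesis
    unfolding crystalline_splitting_poset_def
    using Phi_structured_graph fibrous_graph by blast
qed

end

theorem theorem7p2:
  fixes \<Phi> :: "(real^'n) set" and I :: "'i set" and \<alpha> :: "'i \<Rightarrow> real^'n"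
    and X :: "'x set" and \<mu> dbar :: "'x \<Rightarrow> real^'n" and F :: "'i \<Rightarrow> 'x \<rightharpoonup> 'x"
  assumes "root_system \<Phi>" and "simple_roots \<Phi> I \<alpha>"
    and "admissible_system \<alpha> I X \<mu> dbar F"
  shows "Phi_structured_poset \<alpha> I X (G_graph F) \<and> fibrous I X (G_graph F) \<and>
    (\<forall>t ord. coherent_timing_pattern \<alpha> I X dbar F t \<and> linear_order_on I ord \<longrightarrow>
       (\<forall>J \<nu>. J \<subseteq> I \<longrightarrow>
          J_nu_coloring X (G_graph F) J \<nu> (timing_coloring (G_graph F) ord t J \<nu>))) \<and>
    crystalline_splitting_poset \<Phi> \<alpha> I X (G_graph F) \<and>
    (\<forall>J. \<forall>\<nu> :: 'i \<Rightarrow> nat. J \<subseteq> I \<longrightarrow>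
       (\<forall>m \<in> M_set X (G_graph F) J \<nu>.
          weight_vec \<alpha> J (\<lambda>j. of_nat (\<nu> j)) + wt \<alpha> J (G_graph F) m \<in> dominant_weights \<alpha> J) \<and>
       bialternant_sub \<Phi> \<alpha> J (weight_vec \<alpha> J (\<lambda>j. of_nat (\<nu> j)))
           * restrict_elt \<alpha> J (WGF \<alpha> I X (G_graph F))
         = (\<Sum>m \<in> M_set X (G_graph F) J \<nu>.
              bialternant_sub \<Phi> \<alpha> J
                (weight_vec \<alpha> J (\<lambda>j. of_nat (\<nu> j)) + wt \<alpha> J (G_graph F) m)))"
proof -
  interpret admissible \<Phi> I \<alpha> X \<mu> dbar F
    using assms by unfold_locales
  show ?thesis
    using Phi_structured_graph fibrous_graph J_nu_coloring_timing_coloring crystalline_splitting_graph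
      dominant_add_wt bialternant_mult_WGF
    by (intro conjI allI impI ballI) simp_all
qed

end
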